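(* Let $X=(X_n)_{n\in\mathbb{Z}}$ be a stationary process with values in $(E,\mathcal{E})$, let $\pi$ be a $\sigma$-finite reference measure on $E$, and assume that a regular version of the conditional law of $X_0$ given $(X_k)_{k\le -1}$ has been chosen such that for every $x\in E^{\lhd}$ the law $\mathcal{L}(X_0\mid X^{\lhd}_{-1}=x)$ has a density $f(\cdot|x)$ with respect to $\pi$. Let $(\delta_n)_{n\ge 0}$ be the associated influence sequence $$\delta_n=\sup\big\{\|f(\cdot|xz)-f(\cdot|yz)\| : x\in E^{\lhd},\ y\in E^{\lhd},\ z\in E^n\big\}.$$ (1) If $E$ is finite and $$\sum_{k=0}^{+\infty}\prod_{n=0}^{k}\frac{1-\delta_n}{1+\delta_n}=+\infty,$$ then $\mathcal{F}^X$ admits a generating parametrization. (2) If $E$ has exactly two elements and $$\sum_{k=0}^{+\infty}\prod_{n=0}^{k}(1-\delta_n)=+\infty,$$ then $\mathcal{F}^X$ admits a generating parametrization.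
   Context: Notation. $E^{\lhd}$ is the set of sequences $(\xi_n)_{n\le -1}$ with values in $E$. For a process $X$, $X^{\lhd}_n=(X_k)_{k\le n}$, and any sequence indexed by $\{k\le n\}$ is identified, by shifting indices, with an element of $E^{\lhd}$. For $x\in E^{\lhd}$ and $z=(z_1,\dots,z_n)\in E^n$, $xz=(\dots,x_{-2},x_{-1},z_1,\dots,z_n)\in E^{\lhd}$ is the concatenation. For probability densities $f,g$ on $(E,\pi)$, $\|f-g\|=\frac12\int_E|f-g|\,d\pi$. Filtrations. $\mathcal{F}^X=(\mathcal{F}^X_n)_{n\in\mathbb{Z}}$ with $\mathcal{F}^X_n=\sigma(X_k; k\le n)$; similarly $\mathcal{F}^U_n=\sigma(U_k;k\le n)$ and $\mathcal{F}^{X,U}_n=\sigma(X_k,U_k;k\le n)$. All $\sigma$-fields are assumed to be complete. Parametrizations. A process $U=(U_n)_{n\in\mathbb{Z}}$ (with values in some measurable space) is a parametrization of $X$ (or of $\mathcal{F}^X$) if for every $n\in\mathbb{Z}$: (i) $U_{n+1}$ is independent of $\mathcal{F}^{X,U}_n$, and (ii) $X_{n+1}$ is measurable with respect to $\sigma(U_{n+1})\vee\mathcal{F}^X_n$. It is a generating parametrization if moreover $X_n$ is $\mathcal{F}^U_n$-measurable for every $n\in\mathbb{Z}$. "$\mathcal{F}^X$ admits a generating parametrization" is understood up to an enlargement of the probability space on which $X$ is defined. *)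

theory Defs
  imports "HOL-Probability.Probability"
begin

(* A left-infinite sequence (..., x_{-2}, x_{-1}) is encoded by reading it backwards:
   the function x :: nat => 'e stands for the sequence whose entry at time -1 - j is x j. *)
definition past_space :: "'e measure \<Rightarrow> (nat \<Rightarrow> 'e) measure" where
  "past_space E = PiM UNIV (\<lambda>_. E)"

definition past :: "(int \<Rightarrow> 'a \<Rightarrow> 'e) \<Rightarrow> int \<Rightarrow> 'a \<Rightarrow> nat \<Rightarrow> 'e" where
  "past X n \<omega> = (\<lambda>j. X (n - int j) \<omega>)"

(* z is listed in chronological order, so its last entry becomes the most recent one. *)
definition past_append :: "(nat \<Rightarrow> 'e) \<Rightarrow> 'e list \<Rightarrow> nat \<Rightarrow> 'e" where
  "past_append x z = (\<lambda>j. if j < length z then rev z ! j else x (j - length z))"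

definition density_dist :: "'e measure \<Rightarrow> ('e \<Rightarrow> real) \<Rightarrow> ('e \<Rightarrow> real) \<Rightarrow> real" where
  "density_dist \<pi> f g = 1 / 2 * (\<integral>e. \<bar>f e - g e\<bar> \<partial>\<pi>)"

definition influence :: "'e measure \<Rightarrow> ((nat \<Rightarrow> 'e) \<Rightarrow> 'e \<Rightarrow> real) \<Rightarrow> nat \<Rightarrow> real" where
  "influence \<pi> f n =
     Sup {density_dist \<pi> (f (past_append x z)) (f (past_append y z)) | x y z.
            x \<in> space (past_space \<pi>) \<and> y \<in> space (past_space \<pi>) \<and>
            set z \<subseteq> space \<pi> \<and> length z = n}"

definition stationary_process :: "'a measure \<Rightarrow> 'e measure \<Rightarrow> (int \<Rightarrow> 'a \<Rightarrow> 'e) \<Rightarrow> bool" where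
  "stationary_process M E X \<longleftrightarrow>
     (\<forall>k. X k \<in> M \<rightarrow>\<^sub>M E) \<and>
     (\<forall>m. distr M (PiM UNIV (\<lambda>_. E)) (\<lambda>\<omega> k. X (k + m) \<omega>) =
          distr M (PiM UNIV (\<lambda>_. E)) (\<lambda>\<omega> k. X k \<omega>))"

definition regular_conditional_law ::
  "'a measure \<Rightarrow> 'e measure \<Rightarrow> ('a \<Rightarrow> 'e) \<Rightarrow> 's measure \<Rightarrow> ('a \<Rightarrow> 's) \<Rightarrow> ('s \<Rightarrow> 'e measure) \<Rightarrow> bool" where
  "regular_conditional_law M E Y S Z \<kappa> \<longleftrightarrow>
     \<kappa> \<in> S \<rightarrow>\<^sub>M prob_algebra E \<and>
     (\<forall>A\<in>sets E. AE \<omega> in M.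
        real_cond_exp M (vimage_algebra (space M) Z S) (\<lambda>\<omega>. indicator A (Y \<omega>)) \<omega>
          = measure (\<kappa> (Z \<omega>)) A)"

definition natural_filtration ::
  "'a measure \<Rightarrow> 'e measure \<Rightarrow> (int \<Rightarrow> 'a \<Rightarrow> 'e) \<Rightarrow> int \<Rightarrow> 'a measure" where
  "natural_filtration M E X n =
     sigma (space M)
       ((\<Union>k\<in>{..n}. sets (vimage_algebra (space M) (X k) E)) \<union> null_sets (completion M))"

(* The sigma-fields involved contain all negligible sets, which need not be events of M;
   hence measurability and independence are taken with respect to completion M. *)
definition parametrization ::
  "'a measure \<Rightarrow> 'e measure \<Rightarrow> (int \<Rightarrow> 'a \<Rightarrow> 'e) \<Rightarrow> 'u measure \<Rightarrow> (int \<Rightarrow> 'a \<Rightarrow> 'u) \<Rightarrow> bool" where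
  "parametrization M E X N U \<longleftrightarrow>
     (\<forall>n. U n \<in> completion M \<rightarrow>\<^sub>M N) \<and>
     (\<forall>n. prob_space.indep_set (completion M)
            (sets (vimage_algebra (space M) (U (n + 1)) N))
            (sets (natural_filtration M (E \<Otimes>\<^sub>M N) (\<lambda>k \<omega>. (X k \<omega>, U k \<omega>)) n))) \<and>
     (\<forall>n. X (n + 1) \<in>
            sigma (space M)
              (sets (vimage_algebra (space M) (U (n + 1)) N) \<union> sets (natural_filtration M E X n))
            \<rightarrow>\<^sub>M E)"

definition generating_parametrization ::
  "'a measure \<Rightarrow> 'e measure \<Rightarrow> (int \<Rightarrow> 'a \<Rightarrow> 'e) \<Rightarrow> 'u measure \<Rightarrow> (int \<Rightarrow> 'a \<Rightarrow> 'u) \<Rightarrow> bool" where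
  "generating_parametrization M E X N U \<longleftrightarrow>
     parametrization M E X N U \<and>
     (\<forall>n. X n \<in> natural_filtration M N U n \<rightarrow>\<^sub>M E)"

definition enlargement :: "'a measure \<Rightarrow> 'b measure \<Rightarrow> ('b \<Rightarrow> 'a) \<Rightarrow> bool" where
  "enlargement M M' \<phi> \<longleftrightarrow> prob_space M' \<and> \<phi> \<in> M' \<rightarrow>\<^sub>M M \<and> distr M' M \<phi> = M"

(* HOL cannot quantify existentially over types, so the enlarged sample space and the space in
   which the parametrization takes its values are sought in two fixed types (with arbitrary
   sigma-fields); this only makes the property stronger. *)
definition admits_generating_parametrization ::
  "'a measure \<Rightarrow> 'e measure \<Rightarrow> (int \<Rightarrow> 'a \<Rightarrow> 'e) \<Rightarrow> bool" where
  "admits_generating_parametrization M E X \<longleftrightarrow>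
     (\<exists>(M' :: ('a \<times> (int \<Rightarrow> nat \<Rightarrow> real)) measure) \<phi> (N :: (nat \<Rightarrow> real) measure) U.
        enlargement M M' \<phi> \<and>
        generating_parametrization M' E (\<lambda>n. X n \<circ> \<phi>) N U)"

end

theory Submission
  imports Defs
begin

text \<open>
  Let the process be driven by independent noises: \<open>X\<^sub>n = \<phi>(past, U\<^sub>n)\<close> almost surely, where each
  \<open>U\<^sub>n\<close> is drawn from its conditional law given \<open>X\<^sub>n\<close> and the past of \<open>X\<close>. To see that the noises
  generate \<open>X\<close>, start a copy of \<open>X\<close> at a time \<open>n - N\<close> from an arbitrary fixed past and drive it by the
  same noises. If \<open>\<phi>\<close> couples the conditional laws given two pasts agreeing on the last \<open>l\<close> entries with
  error at most \<open>\<alpha>\<^sub>l\<close>, then the length of the current run of agreement dominates the house of cards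
  chain which jumps from \<open>l\<close> to \<open>0\<close> with probability \<open>\<alpha>\<^sub>l\<close> and to \<open>l + 1\<close> otherwise. Divergence of the
  series means that this chain is not positive recurrent, so the copy differs from \<open>X\<close> at time \<open>n\<close> with
  probability tending to \<open>0\<close> as \<open>N\<close> grows, and \<open>X\<^sub>n\<close> is an almost sure limit of functions of the noises.

  On two points the quantile coupling has error \<open>\<alpha>\<^sub>l = \<delta>\<^sub>l\<close>. On a finite set, rejection sampling (the first
  accepted point of one i.i.d. sequence for all laws simultaneously) has error at most
  \<open>1 - (\<Sum> min) / (\<Sum> max) = 2\<delta>\<^sub>l / (1 + \<delta>\<^sub>l)\<close>.
\<close>

text \<open>The noises have to be attached to a given process, so they are built backwards from its
  path: given the whole path they are independent, each with the law \<open>\<nu>\<close> restricted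
  to the noises that produce the observed value. Averaging over that value restores
  \<open>\<nu>\<close>, whatever the past, and this is what makes the next noise independent of the
  joint past.

  The comparison with the house of cards chain is not realised by a coupling of chains. The
  probability of a final mismatch and the probability that the chain ends at 0 obey backward
  recursions in the number of remaining steps, and induction compares them. This works because the
  latter decreases in the starting state, which rests on the errors being decreasing; both choices
  of error are monotone in \<delta>. The bound is uniform in the two pasts, so the arbitrary start
  of the copy is harmless.

  The sigma-field of a finite set need not separate its points. The construction is therefore
  carried out on natural-number codes of the atoms and transported back at the end.\<close>

section \<open>The house of cards chain\<close>

text \<open>The probability that the chain started at \<open>l\<close> is at \<open>0\<close> after \<open>j\<close> steps.\<close>

primrec house_of_cards :: "(nat \<Rightarrow> real) \<Rightarrow> nat \<Rightarrow> nat \<Rightarrow> real" where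
  "house_of_cards \<alpha> 0 l = (if l = 0 then 1 else 0)"
| "house_of_cards \<alpha> (Suc j) l =
     (1 - \<alpha> l) * house_of_cards \<alpha> j (Suc l) + \<alpha> l * house_of_cards \<alpha> j 0"

context
  fixes \<alpha> :: "nat \<Rightarrow> real"
  assumes alpha_nonneg: "\<And>n. 0 \<le> \<alpha> n" and alpha_le_1: "\<And>n. \<alpha> n \<le> 1" and alpha_decseq: "decseq \<alpha>"
begin

lemma house_of_cards_nonneg: "0 \<le> house_of_cards \<alpha> j l"
  by (induction j arbitrary: l) (auto simp: alpha_nonneg alpha_le_1)

text \<open>One step averages the value at 0, the largest one, with the value one state higher. From
  a higher state the weight of 0 is smaller, because \<alpha> decreases, and the other value is
  smaller by induction.\<close>

lemma house_of_cards_Suc_le: "house_of_cards \<alpha> j (Suc l) \<le> house_of_cards \<alpha> j l"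
proof (induction j arbitrary: l)
  case (Suc j)
  let ?g = "house_of_cards \<alpha> j"
  have anti: "?g l' \<le> ?g l" if "l \<le> l'" for l l'
    using Suc lift_Suc_antimono_le[of ?g l l'] that by blast
  have a: "\<alpha> (Suc l) \<le> \<alpha> l" using alpha_decseq by (simp add: decseq_Suc_iff)
  have "house_of_cards \<alpha> (Suc j) (Suc l)
      = ?g (Suc (Suc l)) * (1 - \<alpha> (Suc l)) + ?g 0 * \<alpha> (Suc l)" by simp
  also have "\<dots> \<le> ?g (Suc l) * (1 - \<alpha> (Suc l)) + ?g 0 * \<alpha> (Suc l)"
    by (intro add_mono mult_right_mono anti) (auto simp: alpha_le_1 alpha_nonneg)
  also have "\<dots> = ?g (Suc l) + (?g 0 - ?g (Suc l)) * \<alpha> (Suc l)" by (simp add: algebra_simps)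
  also have "\<dots> \<le> ?g (Suc l) + (?g 0 - ?g (Suc l)) * \<alpha> l"
    by (intro add_left_mono mult_left_mono a) (simp add: anti)
  finally show ?case by (simp add: algebra_simps)
qed simp

lemma house_of_cards_antimono: "l \<le> l' \<Longrightarrow> house_of_cards \<alpha> j l' \<le> house_of_cards \<alpha> j l"
  using house_of_cards_Suc_le lift_Suc_antimono_le[of "house_of_cards \<alpha> j" l l'] by blast

lemma house_of_cards_return_decseq: "decseq (\<lambda>j. house_of_cards \<alpha> j 0)"
proof (rule decseq_SucI)
  fix j
  have "house_of_cards \<alpha> (Suc j) 0
      \<le> (1 - \<alpha> 0) * house_of_cards \<alpha> j 0 + \<alpha> 0 * house_of_cards \<alpha> j 0"
    by (simp add: mult_left_mono house_of_cards_Suc_le alpha_le_1)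
  then show "house_of_cards \<alpha> (Suc j) 0 \<le> house_of_cards \<alpha> j 0" by (simp add: algebra_simps)
qed

text \<open>Decomposition at the first return to 0, truncated after \<open>j\<close> steps:
  \<open>b k - b (Suc k)\<close> is the probability that this return occurs at time
  \<open>Suc k\<close>, and \<open>b j\<close> that none occurs within \<open>j\<close> steps, in
  which case the chain has climbed to \<open>j\<close>.\<close>

lemma house_of_cards_first_return:
  defines "b \<equiv> \<lambda>k. \<Prod>n<k. 1 - \<alpha> n"
  shows "j \<le> m \<Longrightarrow> house_of_cards \<alpha> m 0 =
    (\<Sum>k<j. (b k - b (Suc k)) * house_of_cards \<alpha> (m - Suc k) 0) + b j * house_of_cards \<alpha> (m - j) j"
proof (induction j)
  case (Suc j)
  obtain r where r: "m - j = Suc r" using Suc.prems by (metis Suc_diff_Suc Suc_le_eq)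
  have "b j * house_of_cards \<alpha> (m - j) j
     = b (Suc j) * house_of_cards \<alpha> r (Suc j) + (b j - b (Suc j)) * house_of_cards \<alpha> r 0"
    unfolding r by (simp add: b_def algebra_simps)
  moreover have "m - Suc j = r" using r by simp
  ultimately show ?case using Suc by simp
qed (simp add: b_def)

text \<open>The terms are the probabilities that the last visit to 0 up to time \<open>m\<close>
  takes place at time \<open>m - k\<close>, and such a visit exists since the chain starts at 0. The
  induction obtains this from the first return decomposition, whose weights telescope.\<close>

lemma house_of_cards_renewal:
  "(\<Sum>k\<le>m. (\<Prod>n<k. 1 - \<alpha> n) * house_of_cards \<alpha> (m - k) 0) = 1"
proof (induction m)
  case (Suc m)
  define b where "b k = (\<Prod>n<k. 1 - \<alpha> n)" for k
  have "house_of_cards \<alpha> (Suc m) 0 = (\<Sum>k\<le>m. (b k - b (Suc k)) * house_of_cards \<alpha> (m - k) 0)"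
    using house_of_cards_first_return[of "Suc m" "Suc m"] unfolding b_def
    by (simp add: lessThan_Suc_atMost del: prod.lessThan_Suc house_of_cards.simps(2))
  moreover have "(\<Sum>k\<le>Suc m. b k * house_of_cards \<alpha> (Suc m - k) 0)
     = house_of_cards \<alpha> (Suc m) 0 + (\<Sum>k\<le>m. b (Suc k) * house_of_cards \<alpha> (m - k) 0)"
    by (subst sum.atMost_Suc_shift) (simp add: b_def del: house_of_cards.simps(2) prod.lessThan_Suc)
  ultimately show ?case
    using Suc by (simp add: b_def[symmetric] left_diff_distrib sum_subtractf)
qed simp

text \<open>Since the return probabilities decrease, each of them in the renewal identity is at
  least the last one. This bounds the last one by the reciprocal of a partial sum of
  \<open>b\<close>, and these partial sums diverge.\<close>

lemma house_of_cards_tendsto_0: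
  assumes "(\<Sum>k. ennreal (\<Prod>n=0..k. 1 - \<alpha> n)) = \<infinity>"
  shows "(\<lambda>j. house_of_cards \<alpha> j 0) \<longlonglongrightarrow> 0"
proof -
  define b where "b k = (\<Prod>n<k. 1 - \<alpha> n)" for k
  define u where "u j = house_of_cards \<alpha> j 0" for j
  have b0: "0 \<le> b k" for k unfolding b_def by (intro prod_nonneg) (simp add: alpha_le_1)
  have ineq: "u m * (\<Sum>k\<le>m. b k) \<le> 1" for m
  proof -
    have "u m * (\<Sum>k\<le>m. b k) = (\<Sum>k\<le>m. b k * u m)" by (simp add: sum_distrib_left mult.commute)
    also have "\<dots> \<le> (\<Sum>k\<le>m. b k * u (m - k))"
      using house_of_cards_return_decseq by (intro sum_mono mult_left_mono b0) (auto simp: decseq_def u_def)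
    also have "\<dots> = 1" using house_of_cards_renewal[of m] by (simp add: b_def u_def)
    finally show ?thesis .
  qed
  have div: "\<not> summable b"
  proof
    assume "summable b"
    \<comment> \<open>The hypothesis speaks of \<open>b (Suc k)\<close>; the empty product
      \<open>b 0\<close> is shifted away.\<close>
    then have "summable (\<lambda>k. b (Suc k))" by (simp add: summable_Suc_iff)
    then have "(\<Sum>k. ennreal (b (Suc k))) = ennreal (\<Sum>k. b (Suc k))"
      using b0 by (intro suminf_ennreal2) auto
    moreover have "b (Suc k) = (\<Prod>n=0..k. 1 - \<alpha> n)" for k
      by (simp add: b_def lessThan_Suc_atMost atMost_atLeast0)
    ultimately show False using assms by simp
  qed
  show ?thesis
  proof (rule LIMSEQ_I)
    fix r :: real assume r: "r > 0"
    have "\<exists>m. (\<Sum>k<m. b k) > 2 / r"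
    proof (rule ccontr)
      assume "\<nexists>m. (\<Sum>k<m. b k) > 2 / r"
      then have "summable b" by (intro bounded_imp_summable[of _ "2/r"] b0) (metis lessThan_Suc_atMost not_le)
      with div show False by simp
    qed
    \<comment> \<open>The factor 2 makes the final estimate strict: the return probability is at
      most \<open>r / 2\<close>.\<close>
    then obtain m where m: "(\<Sum>k<m. b k) > 2 / r" by blast
    have "norm (house_of_cards \<alpha> j 0 - 0) < r" if "j \<ge> m" for j
    proof -
      have "2 / r < (\<Sum>k\<le>j. b k)"
        using m sum_mono2[of "{..j}" "{..<m}" b] b0 that by fastforce
      then have "u j * (2 / r) \<le> 1"
        using ineq[of j] house_of_cards_nonneg[of j 0]
          mult_left_mono[of "2 / r" "\<Sum>k\<le>j. b k" "u j"] by (simp add: u_def)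
      then show ?thesis using r house_of_cards_nonneg[of j 0] by (simp add: u_def field_simps)
    qed
    then show "\<exists>no. \<forall>n\<ge>no. norm (house_of_cards \<alpha> n 0 - 0) < r" by blast
  qed
qed

end

section \<open>Coupling by rejection sampling\<close>

text \<open>One uniform point of \<open>[0, m)\<close> carries both a uniform proposal, its integer
  part, and an independent acceptance level, its fractional part. For \<open>m = 1\<close> the first
  coordinate is a plain uniform variable, which serves for the quantile coupling.\<close>

definition uniform_seq :: "nat \<Rightarrow> (nat \<Rightarrow> real) measure" where
  "uniform_seq m = PiM UNIV (\<lambda>_. uniform_measure lborel {0..<real m})"

lemma sets_uniform_seq[measurable_cong]: "sets (uniform_seq m) = sets (PiM UNIV (\<lambda>_. borel))"
  unfolding uniform_seq_def by (intro sets_PiM_cong) auto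

lemma space_uniform_seq[simp]: "space (uniform_seq m) = UNIV"
  using sets_eq_imp_space_eq[OF sets_uniform_seq[of m]] by (simp add: space_PiM)

context
  fixes m :: nat
  assumes m_pos: "0 < m"
begin

lemma prob_space_uniform: "prob_space (uniform_measure lborel {0..<real m})"
  using m_pos by (intro prob_space_uniform_measure) auto

lemma prob_space_uniform_seq: "prob_space (uniform_seq m)"
  unfolding uniform_seq_def by (intro prob_space_PiM prob_space_uniform)

lemma measure_uniform_cells:
  assumes A: "A \<in> sets borel"
  shows "measure (uniform_measure lborel {0..<real m}) A
    = (\<Sum>a<m. measure lborel (A \<inter> {real a..<real a + 1})) / m"
proof -
  have "{0..<real m} \<inter> A = (\<Union>a\<in>{..<m}. A \<inter> {real a..<real a + 1})"
  proof (intro equalityI subsetI)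
    fix t assume t: "t \<in> {0..<real m} \<inter> A"
    define a where "a = nat \<lfloor>t\<rfloor>"
    have "real a \<le> t" "t < real a + 1" using t unfolding a_def by (auto simp: floor_less_cancel of_nat_floor)
    moreover from this t have "a < m" by simp
    ultimately show "t \<in> (\<Union>a\<in>{..<m}. A \<inter> {real a..<real a + 1})" using t by auto
  qed auto
  moreover have "disjoint_family_on (\<lambda>a. A \<inter> {real a..<real a + 1}) {..<m}"
    by (auto simp: disjoint_family_on_def)
  moreover have "emeasure lborel (A \<inter> {real a..<real a + 1}) \<noteq> \<infinity>" for a
    using emeasure_mono[of "A \<inter> {real a..<real a + 1}" "{real a..<real a + 1}" lborel]
    by (auto simp: top_unique)
  ultimately have "measure lborel ({0..<real m} \<inter> A)
      = (\<Sum>a<m. measure lborel (A \<inter> {real a..<real a + 1}))"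
    using A by (simp only:) (intro measure_finite_Union, auto)
  then show ?thesis
    using A m_pos by (simp add: measure_uniform_measure)
qed

text \<open>An i.i.d. sequence is a first coordinate followed by an independent sequence of the same
  law. This turns probabilities about the first accepted point into one-step equations.\<close>

lemma emeasure_uniform_seq_split:
  assumes A[measurable]: "A \<in> sets (uniform_seq m)"
  shows "emeasure (uniform_seq m) A =
    (\<integral>\<^sup>+t. emeasure (uniform_seq m) {u. case_nat t u \<in> A} \<partial>uniform_measure lborel {0..<real m})"
proof -
  let ?U = "uniform_measure lborel {0..<real m}" and ?S = "uniform_seq m"
  interpret U: prob_space ?U by (rule prob_space_uniform)
  interpret seq: sequence_space ?U by unfold_locales
  interpret S: prob_space ?S by (rule prob_space_uniform_seq)
  have [measurable]: "(\<lambda>(t, u). case_nat t u) \<in> ?U \<Otimes>\<^sub>M ?S \<rightarrow>\<^sub>M ?S"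
    unfolding uniform_seq_def by measurable
  have "emeasure ?S A = emeasure (distr (?U \<Otimes>\<^sub>M ?S) ?S (\<lambda>(t, u). case_nat t u)) A"
    using seq.PiM_iter by (simp add: uniform_seq_def)
  also have "\<dots> = emeasure (?U \<Otimes>\<^sub>M ?S) ((\<lambda>(t, u). case_nat t u) -` A \<inter> space (?U \<Otimes>\<^sub>M ?S))"
    by (intro emeasure_distr) auto
  also have "\<dots> = (\<integral>\<^sup>+t. emeasure ?S (Pair t -` ((\<lambda>(t, u). case_nat t u) -` A \<inter> space (?U \<Otimes>\<^sub>M ?S))) \<partial>?U)"
    by (intro S.emeasure_pair_measure_alt measurable_sets[OF _ A]) fact
  also have "\<dots> = (\<integral>\<^sup>+t. emeasure ?S {u. case_nat t u \<in> A} \<partial>?U)"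
    by (intro nn_integral_cong arg_cong[where f="emeasure ?S"]) (auto simp: space_pair_measure)
  finally show ?thesis .
qed

lemma measure_uniform_seq_0:
  assumes [measurable]: "A \<in> sets borel"
  shows "measure (uniform_seq m) {u. u 0 \<in> A} = measure (uniform_measure lborel {0..<real m}) A"
proof -
  let ?U = "uniform_measure lborel {0..<real m}"
  interpret U: prob_space ?U by (rule prob_space_uniform)
  interpret seq: sequence_space ?U by unfold_locales
  have "emeasure (uniform_seq m) {u. u 0 \<in> A} = emeasure ?U A"
    using seq.emeasure_PiM_Collect_single[of 0 A] by (simp add: uniform_seq_def space_PiM)
  then show ?thesis by (simp add: measure_def)
qed

end

text \<open>A point of the cell \<open>[a, a + 1)\<close> of \<open>[0, m)\<close> proposes the value \<open>a\<close>, accepted with probability \<open>q a\<close>;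
  so \<open>q\<close> is accepted on a set of measure \<open>1 / m\<close>, independently of the probability vector \<open>q\<close>.\<close>

definition accepts :: "(nat \<Rightarrow> real) \<Rightarrow> real \<Rightarrow> bool" where
  "accepts q t \<longleftrightarrow> t < of_int \<lfloor>t\<rfloor> + q (nat \<lfloor>t\<rfloor>)"

text \<open>The default value 0 is immaterial for the intended use: when \<open>q\<close> is a
  probability vector on the \<open>m\<close> proposals, some point is accepted almost
  surely.\<close>

definition first_accepted :: "(nat \<Rightarrow> real) \<Rightarrow> (nat \<Rightarrow> real) \<Rightarrow> nat" where
  "first_accepted q u = (if \<exists>i. accepts q (u i) then nat \<lfloor>u (LEAST i. accepts q (u i))\<rfloor> else 0)"

lemma measurable_accepts[measurable (raw)]:
  assumes q[measurable]: "\<And>a. (\<lambda>x. q x a) \<in> borel_measurable L" and t[measurable]: "t \<in> borel_measurable L"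
  shows "Measurable.pred L (\<lambda>x. accepts (q x) (t x))"
proof -
  have [measurable]: "(\<lambda>x. q x (nat \<lfloor>t x\<rfloor>)) \<in> borel_measurable L"
    by (rule measurable_compose_countable[OF q]) measurable
  show ?thesis unfolding accepts_def by measurable
qed

lemma measurable_first_accepted:
  assumes [measurable]: "\<And>a. (\<lambda>x. q x a) \<in> borel_measurable L"
  shows "(\<lambda>(x, u). first_accepted (q x) u) \<in> L \<Otimes>\<^sub>M uniform_seq m \<rightarrow>\<^sub>M count_space UNIV"
proof -
  have [measurable]: "(\<lambda>p. snd p i) \<in> borel_measurable (L \<Otimes>\<^sub>M uniform_seq m)" for i :: nat
    by measurable
  have [measurable]: "(\<lambda>p. snd p (LEAST i. accepts (q (fst p)) (snd p i))) \<in> borel_measurable (L \<Otimes>\<^sub>M uniform_seq m)"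
    by (rule measurable_compose_countable[where f = "\<lambda>i p. snd p i"]) measurable
  show ?thesis
    unfolding first_accepted_def split_beta by measurable
qed

lemma first_accepted_case_nat:
  "first_accepted q (case_nat t u) = (if accepts q t then nat \<lfloor>t\<rfloor> else first_accepted q u)"
proof (cases "accepts q t")
  case True
  then have "(LEAST i. accepts q (case_nat t u i)) = 0" by (intro Least_eq_0) simp
  moreover have "\<exists>i. accepts q (case_nat t u i)" using True by (intro exI[of _ 0]) simp
  ultimately show ?thesis using True by (simp add: first_accepted_def)
next
  case False
  show ?thesis
  proof (cases "\<exists>i. accepts q (u i)")
    case True
    then obtain i where i: "accepts q (u i)" by blast
    have "(LEAST i. accepts q (case_nat t u i)) = Suc (LEAST i. accepts q (u i))"
      using Least_Suc[of "\<lambda>i. accepts q (case_nat t u i)" "Suc i"] False i by simp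
    moreover have "\<exists>i. accepts q (case_nat t u i)" using i by (intro exI[of _ "Suc i"]) simp
    ultimately show ?thesis using True False by (simp add: first_accepted_def)
  next
    case False': False
    then have "\<not> (\<exists>i. accepts q (case_nat t u i))" using False by (auto split: nat.split)
    then show ?thesis using False False' by (simp add: first_accepted_def)
  qed
qed

context
  fixes m :: nat
  assumes m_pos: "0 < m"
begin

interpretation U: prob_space "uniform_measure lborel {0..<real m}"
  by (rule prob_space_uniform[OF m_pos])
interpretation S: prob_space "uniform_seq m"
  by (rule prob_space_uniform_seq[OF m_pos])

lemma floor_cell: "t \<in> {real a..<real a + 1} \<Longrightarrow> \<lfloor>t\<rfloor> = int a"
  by (auto simp: floor_eq_iff)

text \<open>Splitting off the first trial, the probability \<open>c\<close> solves
  \<open>c = q a / m + c * (1 - 1 / m)\<close>. As \<open>1 / m\<close> is positive,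
  \<open>q a\<close> is the only solution, so neither a geometric series nor almost sure acceptance
  has to be treated.\<close>

lemma measure_first_accepted:
  assumes q: "\<And>a. 0 \<le> q a" "(\<Sum>a<m. q a) = 1" "\<And>a. a \<ge> m \<Longrightarrow> q a = 0"
  shows "measure (uniform_seq m) {u. first_accepted q u = a} = q a"
proof -
  let ?U = "uniform_measure lborel {0..<real m}"
  have q1: "q b \<le> 1" for b
    using member_le_sum[of b "{..<m}" q] q by (cases "b < m") auto
  have [measurable]: "Measurable.pred borel (accepts q)" by measurable
  have fa[measurable]: "first_accepted q \<in> uniform_seq m \<rightarrow>\<^sub>M count_space UNIV"
    using measurable_compose[OF measurable_Pair measurable_first_accepted[of "\<lambda>_. q" "count_space UNIV" m],
        of "\<lambda>_. ()" "uniform_seq m" "\<lambda>u. u"] by simp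
  have fas[measurable]: "{u. first_accepted q u = a} \<in> sets (uniform_seq m)"
    using measurable_sets[OF fa, of "{a}"] by (simp add: vimage_def)
  define c where "c = measure (uniform_seq m) {u. first_accepted q u = a}"
  have "ennreal c = (\<integral>\<^sup>+t. emeasure (uniform_seq m) {u. case_nat t u \<in> {u. first_accepted q u = a}} \<partial>?U)"
    unfolding c_def S.emeasure_eq_measure[symmetric] by (rule emeasure_uniform_seq_split[OF m_pos fas])
  also have "\<dots> = (\<integral>\<^sup>+t. indicator {t. accepts q t \<and> nat \<lfloor>t\<rfloor> = a} t + ennreal c * indicator {t. \<not> accepts q t} t \<partial>?U)"
    using S.emeasure_space_1
    by (intro nn_integral_cong)
       (auto simp: first_accepted_case_nat c_def S.emeasure_eq_measure indicator_def)
  also have "\<dots> = emeasure ?U {t. accepts q t \<and> nat \<lfloor>t\<rfloor> = a} + ennreal c * emeasure ?U {t. \<not> accepts q t}"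
    by (subst nn_integral_add) (auto simp: nn_integral_cmult)
  finally have c: "c = measure ?U {t. accepts q t \<and> nat \<lfloor>t\<rfloor> = a} + c * measure ?U {t. \<not> accepts q t}"
    unfolding U.emeasure_eq_measure by (simp add: ennreal_mult[symmetric] ennreal_plus[symmetric] c_def del: ennreal_plus)
  have "measure lborel ({t. accepts q t \<and> nat \<lfloor>t\<rfloor> = a} \<inter> {real b..<real b + 1}) = (if b = a then q b else 0)" for b
  proof -
    have "{t. accepts q t \<and> nat \<lfloor>t\<rfloor> = a} \<inter> {real b..<real b + 1}
        = {t. t < b + q b \<and> b = a} \<inter> {real b..<real b + 1}"
      by (auto simp: accepts_def floor_cell)
    also have "\<dots> = (if b = a then {real b..<real b + q b} else {})" using q1[of b] by auto
    finally show ?thesis using q(1) by simp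
  qed
  then have "measure ?U {t. accepts q t \<and> nat \<lfloor>t\<rfloor> = a} = (\<Sum>b<m. if b = a then q b else 0) / m"
    by (subst measure_uniform_cells[OF m_pos]) simp_all
  also have "\<dots> = q a / m" using q(3)[of a] by auto
  finally have 1: "measure ?U {t. accepts q t \<and> nat \<lfloor>t\<rfloor> = a} = q a / m" .
  have "measure lborel ({t. \<not> accepts q t} \<inter> {real b..<real b + 1}) = 1 - q b" for b
  proof -
    have "{t. \<not> accepts q t} \<inter> {real b..<real b + 1} = {t. \<not> t < b + q b} \<inter> {real b..<real b + 1}"
      by (auto simp: accepts_def floor_cell)
    also have "\<dots> = {real b + q b..<real b + 1}" using q(1)[of b] by auto
    finally show ?thesis using q1[of b] by simp
  qed
  then have "measure ?U {t. \<not> accepts q t} = (\<Sum>b<m. 1 - q b) / m"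
    by (subst measure_uniform_cells[OF m_pos]) simp_all
  also have "\<dots> = 1 - 1 / m" using q(2) m_pos by (simp add: sum_subtractf field_simps)
  finally have 2: "measure ?U {t. \<not> accepts q t} = 1 - 1 / m" .
  show ?thesis using c m_pos unfolding 1 2 c_def[symmetric] by (simp add: field_simps)
qed

text \<open>If both vectors accept the first point, the results agree, for the proposal is shared.
  If neither does, the experiment starts afresh. Hence \<open>D\<close> is at most the probability
  \<open>2 * d / m\<close> that exactly one accepts, plus \<open>D\<close> times the probability
  that neither does.\<close>

lemma measure_first_accepted_neq:
  assumes q: "\<And>a. 0 \<le> q a" "(\<Sum>a<m. q a) = 1" "\<And>a. 0 \<le> r a" "(\<Sum>a<m. r a) = 1"
    and d: "d = (\<Sum>a<m. \<bar>q a - r a\<bar>) / 2"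
  shows "measure (uniform_seq m) {u. first_accepted q u \<noteq> first_accepted r u} \<le> 2 * d / (1 + d)"
proof -
  let ?U = "uniform_measure lborel {0..<real m}"
  have q1: "q b \<le> 1" "r b \<le> 1" if "b < m" for b
    using member_le_sum[of b "{..<m}" q] member_le_sum[of b "{..<m}" r] q that by auto
  have [measurable]: "Measurable.pred borel (accepts q)" "Measurable.pred borel (accepts r)" by measurable
  have fa[measurable]: "first_accepted p \<in> uniform_seq m \<rightarrow>\<^sub>M count_space UNIV" for p
    using measurable_compose[OF measurable_Pair measurable_first_accepted[of "\<lambda>_. p" "count_space UNIV" m],
        of "\<lambda>_. ()" "uniform_seq m" "\<lambda>u. u"] by simp
  have "{u\<in>space (uniform_seq m). first_accepted q u \<noteq> first_accepted r u} \<in> sets (uniform_seq m)"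
    by measurable
  then have fas[measurable]: "{u. first_accepted q u \<noteq> first_accepted r u} \<in> sets (uniform_seq m)" by simp
  define D where "D = measure (uniform_seq m) {u. first_accepted q u \<noteq> first_accepted r u}"
  let ?X = "{t. accepts q t \<noteq> accepts r t}" and ?N = "{t. \<not> accepts q t \<and> \<not> accepts r t}"
  have "ennreal D = (\<integral>\<^sup>+t. emeasure (uniform_seq m) {u. case_nat t u \<in> {u. first_accepted q u \<noteq> first_accepted r u}} \<partial>?U)"
    unfolding D_def S.emeasure_eq_measure[symmetric] by (rule emeasure_uniform_seq_split[OF m_pos fas])
  also have "\<dots> \<le> (\<integral>\<^sup>+t. indicator ?X t + ennreal D * indicator ?N t \<partial>?U)"
    using S.emeasure_le_1
    by (intro nn_integral_mono)
       (auto simp: first_accepted_case_nat D_def S.emeasure_eq_measure[symmetric] indicator_def)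
  also have "\<dots> = emeasure ?U ?X + ennreal D * emeasure ?U ?N"
    by (subst nn_integral_add) (auto simp: nn_integral_cmult)
  finally have D: "D \<le> measure ?U ?X + D * measure ?U ?N"
    unfolding U.emeasure_eq_measure
    by (simp add: ennreal_mult[symmetric] ennreal_plus[symmetric] D_def del: ennreal_plus)
  have "?X \<inter> {real b..<real b + 1} = {real b + min (q b) (r b)..<real b + max (q b) (r b)}" if "b < m" for b
  proof -
    have "?X \<inter> {real b..<real b + 1} = {t. (t < b + q b) \<noteq> (t < b + r b)} \<inter> {real b..<real b + 1}"
      by (auto simp: accepts_def floor_cell)
    also have "\<dots> = {real b + min (q b) (r b)..<real b + max (q b) (r b)}"
      using q1[OF that] q(1,3)[of b] by (auto simp: min_def max_def)
    finally show ?thesis .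
  qed
  then have "measure lborel (?X \<inter> {real b..<real b + 1}) = \<bar>q b - r b\<bar>" if "b < m" for b
    using that by (simp add: min_def max_def)
  then have "measure ?U ?X = (\<Sum>b<m. \<bar>q b - r b\<bar>) / m"
    by (subst measure_uniform_cells[OF m_pos]) simp_all
  then have 1: "measure ?U ?X = 2 * d / m" by (simp add: d)
  \<comment> \<open>The maximum of the two levels is written as half of sum plus absolute
    difference; summed over all cells these maxima give \<open>1 + d\<close>.\<close>
  have "measure lborel (?N \<inter> {real b..<real b + 1}) = 1 - (q b + r b + \<bar>q b - r b\<bar>) / 2" if "b < m" for b
  proof -
    have "?N \<inter> {real b..<real b + 1} = {t. \<not> t < b + q b \<and> \<not> t < b + r b} \<inter> {real b..<real b + 1}"
      by (auto simp: accepts_def floor_cell)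
    also have "\<dots> = {real b + max (q b) (r b)..<real b + 1}"
      using q1[OF that] q(1,3)[of b] by (auto simp: max_def)
    finally show ?thesis using q1[OF that] by (simp add: max_def abs_if field_simps)
  qed
  then have "measure ?U ?N = (\<Sum>b<m. 1 - (q b + r b + \<bar>q b - r b\<bar>) / 2) / m"
    by (subst measure_uniform_cells[OF m_pos]) simp_all
  also have "\<dots> = 1 - (1 + d) / m"
    using q m_pos by (simp add: sum_subtractf sum.distrib sum_divide_distrib[symmetric] d field_simps)
  finally have 2: "measure ?U ?N = 1 - (1 + d) / m" .
  have "0 \<le> d" unfolding d by (simp add: sum_nonneg)
  then show ?thesis using D m_pos unfolding 1 2 D_def[symmetric] by (simp add: field_simps)
qed

end

section \<open>Completed filtrations\<close>

text \<open>The sets that differ by a null set from a member of the smaller sigma-field form a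
  sigma-field containing all generators. Independence can thus be checked before completion.\<close>

lemma sigma_sets_Un_null_sets:
  assumes "S \<in> sigma_sets (space M) (G \<union> null_sets (completion M))"
  shows "\<exists>T\<in>sigma_sets (space M) G. sym_diff S T \<in> null_sets (completion M)"
  using assms
proof induction
  case (Basic S)
  then show ?case
  proof
    assume "S \<in> null_sets (completion M)"
    then show ?thesis by (intro bexI[of _ "{}"]) (auto intro: sigma_sets.Empty)
  qed (auto intro!: bexI[of _ S])
next
  case Empty
  show ?case by (intro bexI[of _ "{}"]) (simp_all add: sigma_sets.Empty)
next
  case (Compl S)
  then obtain T where T: "T \<in> sigma_sets (space M) G" "sym_diff S T \<in> null_sets (completion M)" by blast
  have "sym_diff (space M - S) (space M - T) \<in> null_sets (completion M)"
    by (rule null_sets_completion_subset[OF _ T(2)]) blast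
  then show ?case using sigma_sets.Compl[OF T(1)] by (rule bexI)
next
  case (Union S)
  then obtain T where T: "\<And>i. T i \<in> sigma_sets (space M) G"
      "\<And>i. sym_diff (S i) (T i) \<in> null_sets (completion M)" by metis
  have "sym_diff (\<Union>i. S i) (\<Union>i. T i) \<in> null_sets (completion M)"
    by (rule null_sets_completion_subset[OF _ null_sets_UN[of "\<lambda>i. sym_diff (S i) (T i)", OF T(2)]]) blast
  then show ?case using sigma_sets.Union[of T, OF T(1)] by (rule bexI)
qed

lemma space_natural_filtration[simp]: "space (natural_filtration M E X n) = space M"
  unfolding natural_filtration_def by (simp add: space_measure_of_conv)

lemma natural_filtration_generator_subset:
  "(\<Union>k\<in>{..n}. sets (vimage_algebra (space M) (X k) E)) \<union> null_sets (completion M) \<subseteq> Pow (space M)"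
proof (intro Un_least UN_least)
  show "sets (vimage_algebra (space M) (X k) E) \<subseteq> Pow (space M)" for k
    using sets.space_closed[of "vimage_algebra (space M) (X k) E"] by simp
  show "null_sets (completion M) \<subseteq> Pow (space M)"
    using sets.space_closed[of "completion M"] by (auto simp: null_sets_def)
qed

lemma sets_natural_filtration:
  "sets (natural_filtration M E X n) =
     sigma_sets (space M) ((\<Union>k\<in>{..n}. sets (vimage_algebra (space M) (X k) E)) \<union> null_sets (completion M))"
  unfolding natural_filtration_def by (rule sets_measure_of) (rule natural_filtration_generator_subset)

lemma null_sets_natural_filtration: "null_sets (completion M) \<subseteq> sets (natural_filtration M E X n)"
  unfolding sets_natural_filtration by auto

lemma measurable_natural_filtration:
  assumes "X k \<in> space M \<rightarrow> space E" "k \<le> n"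
  shows "X k \<in> natural_filtration M E X n \<rightarrow>\<^sub>M E"
proof (rule measurableI)
  fix A assume "A \<in> sets E"
  then have "X k -` A \<inter> space M \<in> sets (vimage_algebra (space M) (X k) E)" by (rule in_vimage_algebra)
  then show "X k -` A \<inter> space (natural_filtration M E X n) \<in> sets (natural_filtration M E X n)"
    using assms(2) unfolding sets_natural_filtration by auto
qed (use assms(1) in auto)

lemma sets_natural_filtration_subset:
  assumes "space G = space M" "null_sets (completion M) \<subseteq> sets G" "\<And>k. k \<le> n \<Longrightarrow> X k \<in> G \<rightarrow>\<^sub>M E"
  shows "sets (natural_filtration M E X n) \<subseteq> sets G"
  unfolding sets_natural_filtration
proof (rule sets.sigma_sets_subset[of _ G, unfolded assms(1)], safe)
  fix k S assume "k \<le> n" "S \<in> sets (vimage_algebra (space M) (X k) E)"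
  then show "S \<in> sets G"
    using sets_image_in_sets[OF assms(1) assms(3)[of k]] by auto
qed (use assms(2) in auto)

lemma AE_imp_null_sets_completion:
  assumes "AE x in M. P x"
  shows "{x\<in>space M. \<not> P x} \<in> null_sets (completion M)"
  using assms by (auto elim!: AE_E intro: null_sets_completion_subset null_sets_completionI)

text \<open>Every subset of the exceptional set is null for the completion and hence belongs to
  \<open>G\<close>, so altering a function there cannot destroy measurability.\<close>

lemma measurable_AE_cong:
  fixes g :: "'a \<Rightarrow> 'b"
  assumes G: "space G = space M" "null_sets (completion M) \<subseteq> sets G"
    and g: "g \<in> G \<rightarrow>\<^sub>M count_space UNIV" and ae: "AE x in M. f x = g x"
  shows "f \<in> G \<rightarrow>\<^sub>M count_space UNIV"
proof (rule measurableI)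
  fix A :: "'b set"
  let ?N = "{x\<in>space M. f x \<noteq> g x}"
  have N: "?N \<in> null_sets (completion M)" using AE_imp_null_sets_completion[OF ae] by simp
  then have "{x\<in>?N. f x \<in> A} \<in> null_sets (completion M)"
    by (rule null_sets_completion_subset[rotated]) auto
  moreover have "g -` A \<inter> space G \<in> sets G" by (rule measurable_sets[OF g]) simp
  ultimately have "((g -` A \<inter> space G) - ?N) \<union> {x\<in>?N. f x \<in> A} \<in> sets G" using N G(2) by auto
  moreover have "f -` A \<inter> space G = ((g -` A \<inter> space G) - ?N) \<union> {x\<in>?N. f x \<in> A}" using G(1) by auto
  ultimately show "f -` A \<inter> space G \<in> sets G" by simp
qed simp

lemma space_past_space_nat[simp]: "space (past_space (count_space (UNIV :: 'a set))) = UNIV"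
  by (simp add: past_space_def space_PiM)

lemma pred_eq_count_space:
  fixes f g :: "'a \<Rightarrow> 'b::countable"
  assumes f: "f \<in> L \<rightarrow>\<^sub>M count_space UNIV" and g: "g \<in> L \<rightarrow>\<^sub>M count_space UNIV"
  shows "Measurable.pred L (\<lambda>x. f x = g x)"
  using f g by (intro measurable_compose_countable[where f = "\<lambda>a x. f x = a" and g = g]) measurable

section \<open>Processes driven by independent noises\<close>

text \<open>The assumption \<open>cond_law\<close> expresses, without conditional expectations, that
  given the past the next value has the law of \<open>\<phi> (past Y n)\<close> under \<nu>. It does
  not yet provide any noise.\<close>

locale driven_process = prob_space M + nu: prob_space \<nu>
  for M :: "'a measure" and \<nu> :: "(nat \<Rightarrow> real) measure" +
  fixes Y :: "int \<Rightarrow> 'a \<Rightarrow> nat" and \<phi> :: "(nat \<Rightarrow> nat) \<Rightarrow> (nat \<Rightarrow> real) \<Rightarrow> nat"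
  assumes Y[measurable]: "\<And>n. Y n \<in> M \<rightarrow>\<^sub>M count_space UNIV"
    and phi[measurable]: "case_prod \<phi> \<in> past_space (count_space UNIV) \<Otimes>\<^sub>M \<nu> \<rightarrow>\<^sub>M count_space UNIV"
    and cond_law: "\<And>n a B. B \<in> sets (past_space (count_space UNIV)) \<Longrightarrow>
      emeasure M {\<omega>\<in>space M. past Y n \<omega> \<in> B \<and> Y (n + 1) \<omega> = a} =
      (\<integral>\<^sup>+\<omega>. indicator B (past Y n \<omega>) * emeasure \<nu> {u\<in>space \<nu>. \<phi> (past Y n \<omega>) u = a} \<partial>M)"
begin

abbreviation S :: "(nat \<Rightarrow> nat) measure" where "S \<equiv> past_space (count_space UNIV)"

lemma measurable_S_component[measurable]: "(\<lambda>s. s i) \<in> S \<rightarrow>\<^sub>M count_space UNIV"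
  unfolding past_space_def by measurable

lemma measurable_into_S:
  assumes "\<And>i. (\<lambda>x. f x i) \<in> L \<rightarrow>\<^sub>M count_space UNIV"
  shows "f \<in> L \<rightarrow>\<^sub>M S"
  unfolding past_space_def using assms by (intro measurable_PiM_single') (auto simp: space_PiM)

lemma measurable_past[measurable]: "past Y n \<in> M \<rightarrow>\<^sub>M S"
  by (rule measurable_into_S) (simp add: past_def)

lemma measurable_phi[measurable (raw)]:
  "f \<in> L \<rightarrow>\<^sub>M S \<Longrightarrow> g \<in> L \<rightarrow>\<^sub>M \<nu> \<Longrightarrow> (\<lambda>x. \<phi> (f x) (g x)) \<in> L \<rightarrow>\<^sub>M count_space UNIV"
  using measurable_compose[OF measurable_Pair phi] by simp

lemma measurable_case_nat_S[measurable (raw)]: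
  assumes [measurable]: "f \<in> L \<rightarrow>\<^sub>M count_space UNIV" "g \<in> L \<rightarrow>\<^sub>M S"
  shows "(\<lambda>x. case_nat (f x) (g x)) \<in> L \<rightarrow>\<^sub>M S"
proof (rule measurable_into_S)
  fix i show "(\<lambda>x. case_nat (f x) (g x) i) \<in> L \<rightarrow>\<^sub>M count_space UNIV" by (cases i) auto
qed

lemma past_Suc: "case_nat (Y (n + 1) \<omega>) (past Y n \<omega>) = past Y (n + 1) \<omega>"
  by (auto simp: past_def fun_eq_iff split: nat.split)

section \<open>Conditional law of the noise given a past and the value it produces\<close>

text \<open>The value in the null case is immaterial.\<close>

definition noise :: "(nat \<Rightarrow> nat) \<Rightarrow> nat \<Rightarrow> (nat \<Rightarrow> real) measure" where
  "noise s a = (if emeasure \<nu> {u\<in>space \<nu>. \<phi> s u = a} = 0 then \<nu>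
     else uniform_measure \<nu> {u\<in>space \<nu>. \<phi> s u = a})"

lemma sets_noise[simp, measurable_cong]: "sets (noise s a) = sets \<nu>"
  by (simp add: noise_def)

lemma space_noise[simp]: "space (noise s a) = space \<nu>"
  by (simp add: noise_def)

lemma fiber_sets[measurable]: "{u\<in>space \<nu>. \<phi> s u = a} \<in> sets \<nu>"
  by measurable

lemma prob_space_noise: "prob_space (noise s a)"
  unfolding noise_def by (auto intro!: prob_space_uniform_measure nu.prob_space_axioms)

text \<open>Bayes' formula is multiplied out by the mass of the fibre, so that it also covers null
  fibres.\<close>

lemma emeasure_noise:
  assumes [measurable]: "B \<in> sets \<nu>"
  shows "emeasure \<nu> {u\<in>space \<nu>. \<phi> s u = a} * emeasure (noise s a) B = emeasure \<nu> {u\<in>space \<nu>. \<phi> s u = a \<and> u \<in> B}"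
proof (cases "emeasure \<nu> {u\<in>space \<nu>. \<phi> s u = a} = 0")
  case True
  have "emeasure \<nu> {u\<in>space \<nu>. \<phi> s u = a \<and> u \<in> B} \<le> emeasure \<nu> {u\<in>space \<nu>. \<phi> s u = a}"
    by (intro emeasure_mono) auto
  then show ?thesis using True by simp
next
  case False
  have "{u\<in>space \<nu>. \<phi> s u = a} \<inter> B = {u\<in>space \<nu>. \<phi> s u = a \<and> u \<in> B}" by auto
  with False show ?thesis
    by (simp add: noise_def nu.emeasure_eq_measure ennreal_times_divide mult_divide_eq_ennreal
        mult.commute[of "ennreal (measure \<nu> {u \<in> space \<nu>. \<phi> s u = a})"])
qed

lemma measurable_emeasure_fiber[measurable]:
  assumes [measurable]: "B \<in> sets \<nu>"
  shows "(\<lambda>s. emeasure \<nu> {u\<in>space \<nu>. \<phi> s u = a \<and> u \<in> B}) \<in> borel_measurable S"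
  by measurable

lemma measurable_emeasure_fiber'[measurable]:
  "(\<lambda>s. emeasure \<nu> {u\<in>space \<nu>. \<phi> s u = a}) \<in> borel_measurable S"
  by measurable

lemma measurable_noise_const: "(\<lambda>s. noise s a) \<in> S \<rightarrow>\<^sub>M prob_algebra \<nu>"
proof (intro measurable_prob_algebraI measurable_subprob_algebra prob_space_noise)
  fix B assume B[measurable]: "B \<in> sets \<nu>"
  have "emeasure (noise s a) B = (if emeasure \<nu> {u\<in>space \<nu>. \<phi> s u = a} = 0 then emeasure \<nu> B
      else emeasure \<nu> {u\<in>space \<nu>. \<phi> s u = a \<and> u \<in> B} / emeasure \<nu> {u\<in>space \<nu>. \<phi> s u = a})" for s
  proof -
    have "{u\<in>space \<nu>. \<phi> s u = a} \<inter> B = {u\<in>space \<nu>. \<phi> s u = a \<and> u \<in> B}" by auto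
    then show ?thesis by (simp add: noise_def)
  qed
  then show "(\<lambda>s. emeasure (noise s a) B) \<in> borel_measurable S" by simp
qed (auto intro: prob_space_imp_subprob_space prob_space_noise)

lemma measurable_noise[measurable (raw)]:
  assumes "f \<in> L \<rightarrow>\<^sub>M S" "g \<in> L \<rightarrow>\<^sub>M count_space UNIV"
  shows "(\<lambda>x. noise (f x) (g x)) \<in> L \<rightarrow>\<^sub>M prob_algebra \<nu>"
  using measurable_compose[OF assms(1) measurable_noise_const] assms(2)
  by (rule measurable_compose_countable[where f="\<lambda>a x. noise (f x) a"])

lemma measurable_emeasure_noise[measurable (raw)]:
  assumes "f \<in> L \<rightarrow>\<^sub>M S" "g \<in> L \<rightarrow>\<^sub>M count_space UNIV" "B \<in> sets \<nu>"
  shows "(\<lambda>x. emeasure (noise (f x) (g x)) B) \<in> borel_measurable L"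
  using measurable_compose[OF measurable_prob_algebraD[OF measurable_noise[OF assms(1,2)]]
      measurable_emeasure_subprob_algebra[OF assms(3)]] .

lemma measurable_indicator_Y[measurable]: "(\<lambda>\<omega>. indicator {a} (Y n \<omega>) :: ennreal) \<in> borel_measurable M"
  by (rule measurable_compose[OF Y]) simp

text \<open>Both sides integrate \<open>h\<close> against an image measure on the space of pasts,
  and \<open>cond_law\<close> says that these two measures agree on every event.\<close>

lemma cond_law_nn_integral:
  assumes [measurable]: "h \<in> borel_measurable S"
  shows "(\<integral>\<^sup>+\<omega>. h (past Y n \<omega>) * indicator {a} (Y (n + 1) \<omega>) \<partial>M)
    = (\<integral>\<^sup>+\<omega>. h (past Y n \<omega>) * emeasure \<nu> {u\<in>space \<nu>. \<phi> (past Y n \<omega>) u = a} \<partial>M)"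
proof -
  let ?D1 = "distr (density M (\<lambda>\<omega>. indicator {a} (Y (n + 1) \<omega>))) S (past Y n)"
  let ?D2 = "distr (density M (\<lambda>\<omega>. emeasure \<nu> {u\<in>space \<nu>. \<phi> (past Y n \<omega>) u = a})) S (past Y n)"
  have "?D1 = ?D2"
  proof (rule measure_eqI)
    fix B assume "B \<in> sets ?D1"
    then have B[measurable]: "B \<in> sets S" by simp
    have "emeasure ?D1 B = (\<integral>\<^sup>+\<omega>. indicator {a} (Y (n + 1) \<omega>) * indicator (past Y n -` B \<inter> space M) \<omega> \<partial>M)"
      by (subst emeasure_distr) (simp_all add: emeasure_density measurable_sets[OF measurable_past B] del: indicator_simps)
    also have "\<dots> = (\<integral>\<^sup>+\<omega>. indicator {\<omega>\<in>space M. past Y n \<omega> \<in> B \<and> Y (n + 1) \<omega> = a} \<omega> \<partial>M)"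
      by (intro nn_integral_cong) (auto simp: indicator_def)
    also have "\<dots> = emeasure M {\<omega>\<in>space M. past Y n \<omega> \<in> B \<and> Y (n + 1) \<omega> = a}"
      by (intro nn_integral_indicator) measurable
    also have "\<dots> = emeasure ?D2 B"
      unfolding cond_law[OF B]
      by (simp add: emeasure_distr emeasure_density)
         (auto intro!: nn_integral_cong simp: indicator_def)
    finally show "emeasure ?D1 B = emeasure ?D2 B" .
  qed simp
  then have "nn_integral ?D1 h = nn_integral ?D2 h" by simp
  then show ?thesis
    by (simp add: nn_integral_distr nn_integral_density mult.commute)
qed

text \<open>The sum over \<open>a\<close> of the probability of \<open>a\<close> times the noise law
  given \<open>a\<close> is the sum of the masses of \<open>B\<close> in the fibres of
  \<open>\<phi> s\<close>. The fibres partition the noise space, so this is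
  \<open>emeasure \<nu> B\<close> for every past \<open>s\<close>.\<close>

lemma noise_mixture:
  assumes h[measurable]: "h \<in> borel_measurable S" and B[measurable]: "B \<in> sets \<nu>"
  shows "(\<integral>\<^sup>+\<omega>. h (past Y n \<omega>) * emeasure (noise (past Y n \<omega>) (Y (n + 1) \<omega>)) B \<partial>M)
    = (\<integral>\<^sup>+\<omega>. h (past Y n \<omega>) \<partial>M) * emeasure \<nu> B"
proof -
  let ?K = "\<lambda>a s. emeasure (noise s a) B" and ?q = "\<lambda>a s. emeasure \<nu> {u\<in>space \<nu>. \<phi> s u = a}"
  have "(\<Sum>a. h (past Y n \<omega>) * ?K a (past Y n \<omega>) * indicator {a} (Y (n + 1) \<omega>))
      = h (past Y n \<omega>) * ?K (Y (n + 1) \<omega>) (past Y n \<omega>)" for \<omega>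
    by (rule suminf_cmult_indicator[where A="\<lambda>a. {a}"]) (auto simp: disjoint_family_on_def)
  then have "(\<integral>\<^sup>+\<omega>. h (past Y n \<omega>) * ?K (Y (n + 1) \<omega>) (past Y n \<omega>) \<partial>M)
    = (\<Sum>a. \<integral>\<^sup>+\<omega>. h (past Y n \<omega>) * ?K a (past Y n \<omega>) * indicator {a} (Y (n + 1) \<omega>) \<partial>M)"
    by (subst nn_integral_suminf[symmetric]) (simp, measurable)
  also have "\<dots> = (\<Sum>a. \<integral>\<^sup>+\<omega>. h (past Y n \<omega>) * ?K a (past Y n \<omega>) * ?q a (past Y n \<omega>) \<partial>M)"
    by (intro suminf_cong cond_law_nn_integral) measurable
  also have "\<dots> = (\<integral>\<^sup>+\<omega>. (\<Sum>a. h (past Y n \<omega>) * emeasure \<nu> {u\<in>space \<nu>. \<phi> (past Y n \<omega>) u = a \<and> u \<in> B}) \<partial>M)"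
    by (subst nn_integral_suminf)
       (auto simp: emeasure_noise[symmetric] mult_ac intro!: suminf_cong nn_integral_cong)
  also have "(\<Sum>a. emeasure \<nu> {u\<in>space \<nu>. \<phi> s u = a \<and> u \<in> B}) = emeasure \<nu> B" for s
  proof -
    have "(\<Sum>a. emeasure \<nu> {u\<in>space \<nu>. \<phi> s u = a \<and> u \<in> B}) = emeasure \<nu> (\<Union>a. {u\<in>space \<nu>. \<phi> s u = a \<and> u \<in> B})"
      by (intro suminf_emeasure) (auto simp: disjoint_family_on_def)
    also have "(\<Union>a. {u\<in>space \<nu>. \<phi> s u = a \<and> u \<in> B}) = B" using sets.sets_into_space[OF B] by auto
    finally show ?thesis .
  qed
  then have "(\<integral>\<^sup>+\<omega>. (\<Sum>a. h (past Y n \<omega>) * emeasure \<nu> {u\<in>space \<nu>. \<phi> (past Y n \<omega>) u = a \<and> u \<in> B}) \<partial>M)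
    = (\<integral>\<^sup>+\<omega>. h (past Y n \<omega>) \<partial>M) * emeasure \<nu> B"
    by (simp add: ennreal_suminf_cmult nn_integral_multc)
  finally show ?thesis .
qed

section \<open>The enlarged probability space\<close>

definition noises :: "'a \<Rightarrow> (int \<Rightarrow> nat \<Rightarrow> real) measure" where
  "noises \<omega> = PiM UNIV (\<lambda>n. noise (past Y (n - 1) \<omega>) (Y n \<omega>))"

text \<open>The semidirect product of \<open>M\<close> with the kernel \<open>noises\<close>: the
  path is drawn first, so the first marginal remains \<open>M\<close>, and then the noises of all
  times at once from an infinite product, which avoids any construction starting at minus
  infinity.\<close>

definition enlarged :: "('a \<times> (int \<Rightarrow> nat \<Rightarrow> real)) measure" where
  "enlarged = M \<bind> (\<lambda>\<omega>. distr (noises \<omega>) (M \<Otimes>\<^sub>M PiM UNIV (\<lambda>_. \<nu>)) (Pair \<omega>))"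

lemma sets_noises[simp, measurable_cong]: "sets (noises \<omega>) = sets (PiM UNIV (\<lambda>_. \<nu>))"
  unfolding noises_def by (intro sets_PiM_cong) auto

lemma space_noises[simp]: "space (noises \<omega>) = space (PiM UNIV (\<lambda>_. \<nu>))"
  by (rule sets_eq_imp_space_eq) simp

lemma prob_space_noises: "prob_space (noises \<omega>)"
  unfolding noises_def by (intro prob_space_PiM prob_space_noise)

lemma emeasure_noises:
  assumes J: "finite J" and B: "\<And>k. k \<in> J \<Longrightarrow> B k \<in> sets \<nu>"
  shows "emeasure (noises \<omega>) {u\<in>space (PiM UNIV (\<lambda>_. \<nu>)). \<forall>k\<in>J. u k \<in> B k}
    = (\<Prod>k\<in>J. emeasure (noise (past Y (k - 1) \<omega>) (Y k \<omega>)) (B k))"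
proof -
  let ?N = "\<lambda>n. noise (past Y (n - 1) \<omega>) (Y n \<omega>)"
  have "{u\<in>space (PiM UNIV (\<lambda>_. \<nu>)). \<forall>k\<in>J. u k \<in> B k} = prod_emb UNIV ?N J (\<Pi>\<^sub>E k\<in>J. B k)"
    by (auto simp: prod_emb_def space_PiM Pi_iff)
  then show ?thesis
    unfolding noises_def using assms
    by (simp add: emeasure_PiM_emb prob_space_noise)
qed

lemma measurable_noises[measurable]: "noises \<in> M \<rightarrow>\<^sub>M prob_algebra (PiM UNIV (\<lambda>_. \<nu>))"
proof (rule measurable_prob_algebra_generated[OF sets_PiM Int_stable_prod_algebra prod_algebra_sets_into_space])
  fix A assume "A \<in> prod_algebra UNIV (\<lambda>_::int. \<nu>)"
  then obtain J B where A: "A = prod_emb UNIV (\<lambda>_. \<nu>) J (\<Pi>\<^sub>E j\<in>J. B j)"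
    and J: "finite J" and B: "\<And>j. j \<in> J \<Longrightarrow> B j \<in> sets \<nu>"
    by (rule prod_algebraE) blast
  have "A = {u\<in>space (PiM UNIV (\<lambda>_. \<nu>)). \<forall>k\<in>J. u k \<in> B k}"
    unfolding A by (auto simp: prod_emb_def space_PiM Pi_iff)
  then show "(\<lambda>\<omega>. emeasure (noises \<omega>) A) \<in> borel_measurable M"
    using B by (simp only: emeasure_noises[OF J B]) (intro borel_measurable_prod_ennreal, measurable)
qed (auto simp: prob_space_noises)

lemma measurable_enlarged_kernel:
  "(\<lambda>\<omega>. distr (noises \<omega>) (M \<Otimes>\<^sub>M PiM UNIV (\<lambda>_. \<nu>)) (Pair \<omega>)) \<in> M \<rightarrow>\<^sub>M prob_algebra (M \<Otimes>\<^sub>M PiM UNIV (\<lambda>_. \<nu>))"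
  by (rule measurable_distr_prob_space2[OF measurable_noises]) simp

lemma sets_enlarged[simp, measurable_cong]: "sets enlarged = sets (M \<Otimes>\<^sub>M PiM UNIV (\<lambda>_. \<nu>))"
  unfolding enlarged_def by (rule sets_bind) (auto simp: not_empty)

lemma space_enlarged: "space enlarged = space M \<times> space (PiM UNIV (\<lambda>_. \<nu>))"
  using sets_eq_imp_space_eq[OF sets_enlarged] by (simp add: space_pair_measure)

lemma nn_integral_enlarged:
  assumes [measurable]: "h \<in> borel_measurable (M \<Otimes>\<^sub>M PiM UNIV (\<lambda>_. \<nu>))"
  shows "(\<integral>\<^sup>+x. h x \<partial>enlarged) = (\<integral>\<^sup>+\<omega>. \<integral>\<^sup>+u. h (\<omega>, u) \<partial>noises \<omega> \<partial>M)"
proof -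
  have "(\<integral>\<^sup>+x. h x \<partial>enlarged)
      = (\<integral>\<^sup>+\<omega>. \<integral>\<^sup>+x. h x \<partial>distr (noises \<omega>) (M \<Otimes>\<^sub>M PiM UNIV (\<lambda>_. \<nu>)) (Pair \<omega>) \<partial>M)"
    unfolding enlarged_def
    by (rule nn_integral_bind[OF assms measurable_prob_algebraD[OF measurable_enlarged_kernel]])
  also have "\<dots> = (\<integral>\<^sup>+\<omega>. \<integral>\<^sup>+u. h (\<omega>, u) \<partial>noises \<omega> \<partial>M)"
  proof (rule nn_integral_cong)
    fix \<omega> assume [simp]: "\<omega> \<in> space M"
    show "(\<integral>\<^sup>+x. h x \<partial>distr (noises \<omega>) (M \<Otimes>\<^sub>M PiM UNIV (\<lambda>_. \<nu>)) (Pair \<omega>)) = (\<integral>\<^sup>+u. h (\<omega>, u) \<partial>noises \<omega>)"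
      by (rule nn_integral_distr) simp_all
  qed
  finally show ?thesis .
qed

lemma prob_space_enlarged: "prob_space enlarged"
proof (rule prob_spaceI)
  have "emeasure enlarged (space enlarged) = (\<integral>\<^sup>+x. 1 \<partial>enlarged)" by simp
  also have "\<dots> = (\<integral>\<^sup>+\<omega>. \<integral>\<^sup>+u. 1 \<partial>noises \<omega> \<partial>M)" by (rule nn_integral_enlarged) simp
  also have "\<dots> = 1"
    using prob_space.emeasure_space_1[OF prob_space_noises] emeasure_space_1 by simp
  finally show "emeasure enlarged (space enlarged) = 1" .
qed

sublocale X: prob_space enlarged by (rule prob_space_enlarged)

lemma measurable_fst_enlarged[measurable]: "fst \<in> enlarged \<rightarrow>\<^sub>M M"
  by measurable

lemma measurable_noise_component[measurable]: "(\<lambda>x. snd x k) \<in> enlarged \<rightarrow>\<^sub>M \<nu>"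
  by measurable

lemma distr_enlarged_fst: "distr enlarged M fst = M"
proof (rule measure_eqI)
  fix A assume "A \<in> sets (distr enlarged M fst)"
  then have A[measurable]: "A \<in> sets M" by simp
  have "emeasure (distr enlarged M fst) A = (\<integral>\<^sup>+x. indicator A x \<partial>distr enlarged M fst)" by simp
  also have "\<dots> = (\<integral>\<^sup>+x. indicator A (fst x) \<partial>enlarged)"
    by (intro nn_integral_distr) measurable
  also have "\<dots> = (\<integral>\<^sup>+\<omega>. \<integral>\<^sup>+u. indicator A (fst (\<omega>, u)) \<partial>noises \<omega> \<partial>M)"
    by (rule nn_integral_enlarged) measurable
  also have "\<dots> = (\<integral>\<^sup>+\<omega>. indicator A \<omega> \<partial>M)"
    using prob_space.emeasure_space_1[OF prob_space_noises] by (simp del: nn_integral_indicator)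
  finally show "emeasure (distr enlarged M fst) A = emeasure M A" by simp
qed simp

lemma enlargement_enlarged: "enlargement M enlarged fst"
  unfolding enlargement_def using prob_space_enlarged distr_enlarged_fst by simp

lemma emeasure_enlarged_cylinder:
  assumes A[measurable]: "A \<in> sets M" and J: "finite J" and B: "\<And>k. k \<in> J \<Longrightarrow> B k \<in> sets \<nu>"
  shows "emeasure enlarged {x\<in>space enlarged. fst x \<in> A \<and> (\<forall>k\<in>J. snd x k \<in> B k)}
    = (\<integral>\<^sup>+\<omega>. indicator A \<omega> * (\<Prod>k\<in>J. emeasure (noise (past Y (k - 1) \<omega>) (Y k \<omega>)) (B k)) \<partial>M)"
proof -
  let ?C = "{x\<in>space enlarged. fst x \<in> A \<and> (\<forall>k\<in>J. snd x k \<in> B k)}"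
  let ?D = "{u\<in>space (PiM UNIV (\<lambda>_. \<nu>)). \<forall>k\<in>J. u k \<in> B k}"
  have "Measurable.pred enlarged (\<lambda>x. fst x \<in> A)" by measurable
  moreover have "Measurable.pred enlarged (\<lambda>x. snd x k \<in> B k)" if "k \<in> J" for k
    using B[OF that] by measurable
  ultimately have C: "?C \<in> sets enlarged"
    using J by (intro predE pred_intros_logic pred_intros_finite) auto
  have D: "?D \<in> sets (PiM UNIV (\<lambda>_. \<nu>))"
    using J B by (intro predE pred_intros_finite) (auto intro!: measurable_sets_Collect)
  have "emeasure enlarged ?C = (\<integral>\<^sup>+x. indicator ?C x \<partial>enlarged)" using C by simp
  also have "\<dots> = (\<integral>\<^sup>+\<omega>. \<integral>\<^sup>+u. indicator ?C (\<omega>, u) \<partial>noises \<omega> \<partial>M)"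
    using C by (intro nn_integral_enlarged) simp
  also have "\<dots> = (\<integral>\<^sup>+\<omega>. \<integral>\<^sup>+u. indicator A \<omega> * indicator ?D u \<partial>noises \<omega> \<partial>M)"
    by (intro nn_integral_cong) (auto simp: indicator_def space_enlarged)
  also have "\<dots> = (\<integral>\<^sup>+\<omega>. indicator A \<omega> * emeasure (noises \<omega>) ?D \<partial>M)"
    using D by (simp add: nn_integral_cmult)
  finally show ?thesis by (simp add: emeasure_noises[OF J B])
qed

text \<open>The whole past of \<open>Y\<close> is kept as one factor because the laws of the noises
  up to time \<open>n\<close> are functions of it. Only finitely many noises are constrained, so the
  conditional probability of a cylinder is a finite product.\<close>

definition cylinders :: "int \<Rightarrow> ('a \<times> (int \<Rightarrow> nat \<Rightarrow> real)) set set" where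
  "cylinders n = {{x\<in>space enlarged. past Y n (fst x) \<in> A \<and> (\<forall>k\<in>J. snd x k \<in> B k)} | A J B.
     A \<in> sets S \<and> finite J \<and> J \<subseteq> {..n} \<and> (\<forall>k. B k \<in> sets \<nu>)}"

text \<open>The joint history of process and noises before completion; null sets enter only when the
  parametrization is assembled.\<close>

definition joint_past :: "int \<Rightarrow> ('a \<times> (int \<Rightarrow> nat \<Rightarrow> real)) measure" where
  "joint_past n = sigma (space enlarged) (cylinders n)"

lemma cylinders_subset: "cylinders n \<subseteq> Pow (space enlarged)"
  unfolding cylinders_def by auto

lemma sets_joint_past: "sets (joint_past n) = sigma_sets (space enlarged) (cylinders n)"
  unfolding joint_past_def using cylinders_subset by (rule sets_measure_of)

lemma space_joint_past[simp]: "space (joint_past n) = space enlarged"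
  unfolding joint_past_def by (simp add: space_measure_of_conv)

lemma Int_stable_cylinders: "Int_stable (cylinders n)"
proof (rule Int_stableI)
  fix C C' assume "C \<in> cylinders n" "C' \<in> cylinders n"
  then obtain A J B A' J' B' where
    C: "C = {x\<in>space enlarged. past Y n (fst x) \<in> A \<and> (\<forall>k\<in>J. snd x k \<in> B k)}"
      "A \<in> sets S" "finite J" "J \<subseteq> {..n}" "\<forall>k. B k \<in> sets \<nu>" and
    C': "C' = {x\<in>space enlarged. past Y n (fst x) \<in> A' \<and> (\<forall>k\<in>J'. snd x k \<in> B' k)}"
      "A' \<in> sets S" "finite J'" "J' \<subseteq> {..n}" "\<forall>k. B' k \<in> sets \<nu>"
    unfolding cylinders_def by blast
  \<comment> \<open>Outside its own index set each cylinder receives the trivial constraint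
    \<open>space \<nu>\<close>, so that both can be written over the union.\<close>
  let ?B = "\<lambda>k. (if k \<in> J then B k else space \<nu>) \<inter> (if k \<in> J' then B' k else space \<nu>)"
  have "snd x k \<in> space \<nu>" if "x \<in> space enlarged" for x k
    using that by (auto simp: space_enlarged space_PiM)
  then have "C \<inter> C' = {x\<in>space enlarged. past Y n (fst x) \<in> A \<inter> A' \<and> (\<forall>k\<in>J \<union> J'. snd x k \<in> ?B k)}"
    unfolding C C' by auto
  then show "C \<inter> C' \<in> cylinders n"
    unfolding cylinders_def using C C'
    by (intro CollectI exI[of _ "A \<inter> A'"] exI[of _ "J \<union> J'"] exI[of _ ?B]) auto
qed

lemma past_shift: "past Y (k - 1) \<omega> = (\<lambda>i. past Y n \<omega> (i + nat (n - k + 1)))" if "k \<le> n"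
  using that by (auto simp: past_def fun_eq_iff intro!: arg_cong[where f="\<lambda>k. Y k \<omega>"])

lemma past_component: "Y k \<omega> = past Y n \<omega> (nat (n - k))" if "k \<le> n"
  using that by (simp add: past_def)

lemma cylinder_in_sets:
  assumes "C \<in> cylinders n" shows "C \<in> sets enlarged"
proof -
  obtain A J B where C: "C = {x\<in>space enlarged. past Y n (fst x) \<in> A \<and> (\<forall>k\<in>J. snd x k \<in> B k)}"
    and [measurable]: "A \<in> sets S" "\<And>k. B k \<in> sets \<nu>" and "finite J"
    using assms unfolding cylinders_def by blast
  have "countable J" using \<open>finite J\<close> by (rule countable_finite)
  then show ?thesis unfolding C by measurable
qed

text \<open>Given the path, the constraint on the noise at time \<open>n + 1\<close> is a separate
  factor, and the rest is a function of the past at time \<open>n\<close>. Against such a function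
  \<open>noise_mixture\<close> replaces the factor by the constant
  \<open>emeasure \<nu> D\<close>.\<close>

lemma emeasure_cylinder_Int:
  assumes "C \<in> cylinders n" and D[measurable]: "D \<in> sets \<nu>"
  shows "emeasure enlarged {x\<in>C. snd x (n + 1) \<in> D} = emeasure enlarged C * emeasure \<nu> D"
proof -
  obtain A J B where C: "C = {x\<in>space enlarged. past Y n (fst x) \<in> A \<and> (\<forall>k\<in>J. snd x k \<in> B k)}"
    and A[measurable]: "A \<in> sets S" and J: "finite J" "J \<subseteq> {..n}" and B[measurable]: "\<And>k. B k \<in> sets \<nu>"
    using assms unfolding cylinders_def by blast
  let ?A = "past Y n -` A \<inter> space M"
  have A': "?A \<in> sets M" by measurable
  \<comment> \<open>This is the conditional probability of \<open>C\<close> given the path, read off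
    from the past at time \<open>n\<close> alone: entry \<open>n - k\<close> is the value at time
    \<open>k\<close>, and dropping \<open>n - k + 1\<close> entries leaves the past at time
    \<open>k - 1\<close>.\<close>
  define h where "h s = (indicator A s :: ennreal) *
    (\<Prod>k\<in>J. emeasure (noise (\<lambda>i. s (i + nat (n - k + 1))) (s (nat (n - k)))) (B k))" for s
  have shift[measurable]: "(\<lambda>s i. s (i + r)) \<in> S \<rightarrow>\<^sub>M S" for r
    by (rule measurable_into_S) measurable
  have h[measurable]: "h \<in> borel_measurable S"
    unfolding h_def by measurable
  have hY: "h (past Y n \<omega>) = indicator ?A \<omega> * (\<Prod>k\<in>J. emeasure (noise (past Y (k - 1) \<omega>) (Y k \<omega>)) (B k))"
    if "\<omega> \<in> space M" for \<omega>
    unfolding h_def using that J(2)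
    by (auto simp: indicator_def past_shift[of _ n] past_component[of _ n, symmetric] intro!: prod.cong)
  have n: "n + 1 \<notin> J" using J(2) by auto
  have "emeasure enlarged C = emeasure enlarged {x\<in>space enlarged. fst x \<in> ?A \<and> (\<forall>k\<in>J. snd x k \<in> B k)}"
    unfolding C by (intro arg_cong[where f="emeasure enlarged"]) (auto simp: space_enlarged)
  also have "\<dots> = (\<integral>\<^sup>+\<omega>. h (past Y n \<omega>) \<partial>M)"
    by (subst emeasure_enlarged_cylinder[OF A' J(1) B]) (auto intro!: nn_integral_cong simp: hY)
  finally have 1: "emeasure enlarged C = (\<integral>\<^sup>+\<omega>. h (past Y n \<omega>) \<partial>M)" .
  let ?B = "\<lambda>k. if k = n + 1 then D else B k"
  have "{x\<in>C. snd x (n + 1) \<in> D} = {x\<in>space enlarged. fst x \<in> ?A \<and> (\<forall>k\<in>insert (n + 1) J. snd x k \<in> ?B k)}"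
    unfolding C using n by (auto simp: space_enlarged)
  then have "emeasure enlarged {x\<in>C. snd x (n + 1) \<in> D}
    = (\<integral>\<^sup>+\<omega>. indicator ?A \<omega> * (\<Prod>k\<in>insert (n + 1) J. emeasure (noise (past Y (k - 1) \<omega>) (Y k \<omega>)) (?B k)) \<partial>M)"
    by (simp only:) (rule emeasure_enlarged_cylinder[OF A'], use J in auto)
  also have "\<dots> = (\<integral>\<^sup>+\<omega>. h (past Y n \<omega>) * emeasure (noise (past Y n \<omega>) (Y (n + 1) \<omega>)) D \<partial>M)"
  proof (rule nn_integral_cong)
    fix \<omega> assume "\<omega> \<in> space M"
    moreover have "(\<Prod>k\<in>J. emeasure (noise (past Y (k - 1) \<omega>) (Y k \<omega>)) (?B k))
      = (\<Prod>k\<in>J. emeasure (noise (past Y (k - 1) \<omega>) (Y k \<omega>)) (B k))"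
      using n by (intro prod.cong) auto
    ultimately show "indicator ?A \<omega> * (\<Prod>k\<in>insert (n + 1) J. emeasure (noise (past Y (k - 1) \<omega>) (Y k \<omega>)) (?B k))
      = h (past Y n \<omega>) * emeasure (noise (past Y n \<omega>) (Y (n + 1) \<omega>)) D"
      using J(1) n by (simp add: hY mult_ac)
  qed
  also have "\<dots> = (\<integral>\<^sup>+\<omega>. h (past Y n \<omega>) \<partial>M) * emeasure \<nu> D"
    by (rule noise_mixture) measurable
  finally show ?thesis unfolding 1 .
qed

lemma UNIV_in_sets_S[simp]: "UNIV \<in> sets S"
  using sets.top[of S] by simp

lemma cylinders_UNIV: "space enlarged \<in> cylinders n"
  unfolding cylinders_def
  by (intro CollectI exI[of _ "space S"] exI[of _ "{}"] exI[of _ "\<lambda>_. {}"]) auto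

lemma joint_past_subset: "sets (joint_past n) \<subseteq> sets enlarged"
  unfolding sets_joint_past using cylinder_in_sets by (intro sets.sigma_sets_subset) auto

lemma emeasure_joint_past_Int:
  assumes "C \<in> sets (joint_past n)" and D[measurable]: "D \<in> sets \<nu>"
  shows "emeasure enlarged {x\<in>C. snd x (n + 1) \<in> D} = emeasure enlarged C * emeasure \<nu> D"
proof -
  have noise_law: "emeasure enlarged {x\<in>space enlarged. snd x (n + 1) \<in> D} = emeasure \<nu> D"
    using emeasure_cylinder_Int[OF cylinders_UNIV D] by (simp add: X.emeasure_space_1)
  have "X.indep_set (cylinders n) {{x\<in>space enlarged. snd x (n + 1) \<in> D}}"
  proof (rule X.indep_setI)
    show "cylinders n \<subseteq> sets enlarged" using cylinder_in_sets by auto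
    have "{x\<in>space enlarged. snd x (n + 1) \<in> D} \<in> sets enlarged" by measurable
    then show "{{x\<in>space enlarged. snd x (n + 1) \<in> D}} \<subseteq> sets enlarged" by blast
    fix C E assume C: "C \<in> cylinders n" and E: "E \<in> {{x\<in>space enlarged. snd x (n + 1) \<in> D}}"
    have "C \<inter> E = {x\<in>C. snd x (n + 1) \<in> D}" using C E cylinders_subset by auto
    then show "X.prob (C \<inter> E) = X.prob C * X.prob E"
      using emeasure_cylinder_Int[OF C D] noise_law E by (simp add: measure_def enn2real_mult)
  qed
  then have "X.indep_set (sigma_sets (space enlarged) (cylinders n))
      (sigma_sets (space enlarged) {{x\<in>space enlarged. snd x (n + 1) \<in> D}})"
    by (rule X.indep_set_sigma_sets[OF _ Int_stable_cylinders]) (auto simp: Int_stable_def)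
  from X.indep_setD[OF this, of C "{x\<in>space enlarged. snd x (n + 1) \<in> D}"]
  have "X.prob (C \<inter> {x\<in>space enlarged. snd x (n + 1) \<in> D}) = X.prob C * X.prob {x\<in>space enlarged. snd x (n + 1) \<in> D}"
    using assms(1) by (auto simp: sets_joint_past)
  moreover have "C \<inter> {x\<in>space enlarged. snd x (n + 1) \<in> D} = {x\<in>C. snd x (n + 1) \<in> D}"
    using sets.sets_into_space[OF assms(1)] by auto
  ultimately show ?thesis
    using noise_law by (simp add: X.emeasure_eq_measure ennreal_mult)
qed

lemma measurable_joint_past_noise:
  assumes "k \<le> n" shows "(\<lambda>x. snd x k) \<in> joint_past n \<rightarrow>\<^sub>M \<nu>"
proof (rule measurableI)
  fix D assume D: "D \<in> sets \<nu>"
  have "(\<lambda>x. snd x k) -` D \<inter> space (joint_past n) \<in> cylinders n"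
    unfolding cylinders_def using D assms
    by (intro CollectI exI[of _ "space S"] exI[of _ "{k}"] exI[of _ "\<lambda>_. D"]) auto
  then show "(\<lambda>x. snd x k) -` D \<inter> space (joint_past n) \<in> sets (joint_past n)"
    unfolding sets_joint_past by auto
qed (auto simp: space_enlarged space_PiM)

lemma measurable_joint_past_past: "(\<lambda>x. past Y n (fst x)) \<in> joint_past n \<rightarrow>\<^sub>M S"
proof (rule measurableI)
  fix A assume A: "A \<in> sets S"
  have "(\<lambda>x. past Y n (fst x)) -` A \<inter> space (joint_past n) \<in> cylinders n"
    unfolding cylinders_def using A
    by (intro CollectI exI[of _ A] exI[of _ "{}"] exI[of _ "\<lambda>_. {}"]) auto
  then show "(\<lambda>x. past Y n (fst x)) -` A \<inter> space (joint_past n) \<in> sets (joint_past n)"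
    unfolding sets_joint_past by auto
qed simp

text \<open>The pair of \<open>V\<close> and the next noise has a product law by independence, so
  the noise can be integrated out first with \<open>V\<close> frozen.\<close>

lemma nn_integral_joint_past:
  assumes V[measurable]: "V \<in> joint_past n \<rightarrow>\<^sub>M L"
    and h[measurable]: "h \<in> borel_measurable (L \<Otimes>\<^sub>M \<nu>)"
  shows "(\<integral>\<^sup>+x. h (V x, snd x (n + 1)) \<partial>enlarged) = (\<integral>\<^sup>+x. \<integral>\<^sup>+u. h (V x, u) \<partial>\<nu> \<partial>enlarged)"
proof -
  have V'[measurable]: "V \<in> enlarged \<rightarrow>\<^sub>M L"
    using V joint_past_subset[of n] by (auto simp: measurable_def)
  let ?D = "distr enlarged (L \<Otimes>\<^sub>M \<nu>) (\<lambda>x. (V x, snd x (n + 1)))"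
  interpret DV: prob_space "distr enlarged L V" by (rule X.prob_space_distr) simp
  have "distr enlarged L V \<Otimes>\<^sub>M \<nu> = ?D"
  proof (rule pair_measure_eqI)
    fix A D assume A: "A \<in> sets (distr enlarged L V)" and D: "D \<in> sets \<nu>"
    have "V -` A \<inter> space enlarged \<in> sets (joint_past n)"
      using measurable_sets[OF V] A by simp
    note emeasure_joint_past_Int[OF this D]
    moreover have "(\<lambda>x. (V x, snd x (n + 1))) -` (A \<times> D) \<inter> space enlarged
        = {x\<in>V -` A \<inter> space enlarged. snd x (n + 1) \<in> D}" by auto
    ultimately show "emeasure (distr enlarged L V) A * emeasure \<nu> D = emeasure ?D (A \<times> D)"
      using A D by (simp add: emeasure_distr)
  qed (auto intro!: DV.sigma_finite_measure_axioms nu.sigma_finite_measure_axioms)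
  then have "nn_integral ?D h = nn_integral (distr enlarged L V \<Otimes>\<^sub>M \<nu>) h" by simp
  also have "\<dots> = (\<integral>\<^sup>+y. \<integral>\<^sup>+u. h (y, u) \<partial>\<nu> \<partial>distr enlarged L V)"
    by (rule nu.nn_integral_fst[symmetric]) simp
  also have "\<dots> = (\<integral>\<^sup>+x. \<integral>\<^sup>+u. h (V x, u) \<partial>\<nu> \<partial>enlarged)"
    by (subst nn_integral_distr) auto
  finally show ?thesis by (simp add: nn_integral_distr)
qed

text \<open>The noise is drawn inside the fibre over the actual value whenever that fibre has
  positive mass, and almost surely the actual value is not one of the values with a null
  fibre.\<close>

lemma AE_driven: "AE x in enlarged. Y (n + 1) (fst x) = \<phi> (past Y n (fst x)) (snd x (n + 1))"
proof -
  have null: "AE \<omega> in M. emeasure \<nu> {u\<in>space \<nu>. \<phi> (past Y n \<omega>) u = Y (n + 1) \<omega>} \<noteq> 0"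
  proof -
    have "AE \<omega> in M. \<not> (Y (n + 1) \<omega> = a \<and> emeasure \<nu> {u\<in>space \<nu>. \<phi> (past Y n \<omega>) u = a} = 0)" for a
    proof -
      \<comment> \<open>The conditional law is tested on the pasts from which \<open>a\<close> has
        probability zero. Since there are countably many values, all of them can then be excluded at
        once.\<close>
      let ?Z = "\<lambda>s. indicator {s. emeasure \<nu> {u\<in>space \<nu>. \<phi> s u = a} = 0} s :: ennreal"
      have [measurable]: "?Z \<in> borel_measurable S" by measurable
      have "(\<integral>\<^sup>+\<omega>. ?Z (past Y n \<omega>) * indicator {a} (Y (n + 1) \<omega>) \<partial>M)
          = (\<integral>\<^sup>+\<omega>. ?Z (past Y n \<omega>) * emeasure \<nu> {u\<in>space \<nu>. \<phi> (past Y n \<omega>) u = a} \<partial>M)"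
        by (rule cond_law_nn_integral) measurable
      also have "\<dots> = (\<integral>\<^sup>+\<omega>. 0 \<partial>M)" by (intro nn_integral_cong) (simp split: split_indicator)
      finally have "(\<integral>\<^sup>+\<omega>. ?Z (past Y n \<omega>) * indicator {a} (Y (n + 1) \<omega>) \<partial>M) = 0" by simp
      moreover have "(\<lambda>\<omega>. ?Z (past Y n \<omega>) * indicator {a} (Y (n + 1) \<omega>)) \<in> borel_measurable M"
        by measurable
      ultimately have "AE \<omega> in M. ?Z (past Y n \<omega>) * indicator {a} (Y (n + 1) \<omega>) = 0"
        by (simp only: nn_integral_0_iff_AE)
      then show ?thesis by eventually_elim (auto simp: indicator_def split: if_splits)
    qed
    then have "AE \<omega> in M. \<forall>a. \<not> (Y (n + 1) \<omega> = a \<and> emeasure \<nu> {u\<in>space \<nu>. \<phi> (past Y n \<omega>) u = a} = 0)"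
      by (subst AE_all_countable) simp
    then show ?thesis by eventually_elim auto
  qed
  let ?E = "{x\<in>space enlarged. Y (n + 1) (fst x) \<noteq> \<phi> (past Y n (fst x)) (snd x (n + 1))}"
  have [measurable]: "(\<lambda>x. Y (n + 1) (fst x)) \<in> enlarged \<rightarrow>\<^sub>M count_space UNIV"
    "(\<lambda>x. past Y n (fst x)) \<in> enlarged \<rightarrow>\<^sub>M S"
    using measurable_compose[OF measurable_fst_enlarged Y] measurable_compose[OF measurable_fst_enlarged measurable_past] .
  have [measurable]: "(\<lambda>x. \<phi> (past Y n (fst x)) (snd x (n + 1))) \<in> enlarged \<rightarrow>\<^sub>M count_space UNIV"
    by measurable
  have E: "?E \<in> sets enlarged" by (intro predE pred_intros_logic pred_eq_count_space) measurable
  have "emeasure enlarged ?E = (\<integral>\<^sup>+x. indicator ?E x \<partial>enlarged)" using E by simp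
  also have "\<dots> = (\<integral>\<^sup>+\<omega>. \<integral>\<^sup>+u. indicator ?E (\<omega>, u) \<partial>noises \<omega> \<partial>M)"
    using E by (intro nn_integral_enlarged) simp
  also have "\<dots> = (\<integral>\<^sup>+\<omega>. 0 \<partial>M)"
  proof (rule nn_integral_cong_AE, use null in eventually_elim)
    fix \<omega> assume pos: "emeasure \<nu> {u\<in>space \<nu>. \<phi> (past Y n \<omega>) u = Y (n + 1) \<omega>} \<noteq> 0"
    let ?F = "{u\<in>space \<nu>. \<phi> (past Y n \<omega>) u = Y (n + 1) \<omega>}"
    have null: "emeasure (noise (past Y n \<omega>) (Y (n + 1) \<omega>)) (space \<nu> - ?F) = 0"
      using pos by (simp add: noise_def Int_Diff)
    let ?G = "{u\<in>space (PiM UNIV (\<lambda>_. \<nu>)). u (n + 1) \<in> space \<nu> - ?F}"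
    have "(\<integral>\<^sup>+u. indicator ?E (\<omega>, u) \<partial>noises \<omega>) \<le> (\<integral>\<^sup>+u. indicator ?G u \<partial>noises \<omega>)"
      by (intro nn_integral_mono) (auto simp: indicator_def space_enlarged space_PiM PiE_iff)
    also have "\<dots> = emeasure (noises \<omega>) ?G"
      by (intro nn_integral_indicator) measurable
    also have "\<dots> = emeasure (noise (past Y n \<omega>) (Y (n + 1) \<omega>)) (space \<nu> - ?F)"
      using emeasure_noises[of "{n + 1}" "\<lambda>_. space \<nu> - ?F" \<omega>] by simp
    finally show "(\<integral>\<^sup>+u. indicator ?E (\<omega>, u) \<partial>noises \<omega>) = 0" using null by simp
  qed
  finally have "emeasure enlarged ?E = 0" by simp
  then show ?thesis using E by (auto intro!: AE_I[of _ _ ?E])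
qed

section \<open>Comparison of the process with a simulated copy\<close>

text \<open>The maps \<open>discrepancy j (s, t)\<close> give the probability that two copies started from the pasts
  \<open>s\<close> and \<open>t\<close> and driven by the same noise differ after \<open>j\<close> steps.\<close>

primrec discrepancy :: "nat \<Rightarrow> (nat \<Rightarrow> nat) \<times> (nat \<Rightarrow> nat) \<Rightarrow> ennreal" where
  "discrepancy 0 = (\<lambda>p. of_bool (fst p 0 \<noteq> snd p 0))"
| "discrepancy (Suc j) = (\<lambda>p. \<integral>\<^sup>+u. discrepancy j
     (case_nat (\<phi> (fst p) u) (fst p), case_nat (\<phi> (snd p) u) (snd p)) \<partial>\<nu>)"

lemma measurable_discrepancy[measurable]: "discrepancy j \<in> borel_measurable (S \<Otimes>\<^sub>M S)"
proof (induction j)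
  case (Suc j)
  note [measurable] = Suc
  show ?case unfolding discrepancy.simps by measurable
next
  case 0
  have [measurable]: "(\<lambda>p. fst p 0) \<in> S \<Otimes>\<^sub>M S \<rightarrow>\<^sub>M count_space UNIV" "(\<lambda>p. snd p 0) \<in> S \<Otimes>\<^sub>M S \<rightarrow>\<^sub>M count_space UNIV"
    using measurable_compose[OF measurable_fst measurable_S_component]
      measurable_compose[OF measurable_snd measurable_S_component] .
  have [measurable]: "Measurable.pred (S \<Otimes>\<^sub>M S) (\<lambda>p. fst p 0 = snd p 0)"
    by (rule pred_eq_count_space) measurable
  show ?case unfolding discrepancy.simps of_bool_def by measurable
qed

text \<open>Entry 0 is the simulated value at time \<open>n + j\<close>, and only the noises at
  times \<open>n + 1\<close> to \<open>n + j\<close> are used, so the copy is a function of the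
  noises.\<close>

primrec simulated_past :: "int \<Rightarrow> nat \<Rightarrow> (int \<Rightarrow> nat \<Rightarrow> real) \<Rightarrow> nat \<Rightarrow> nat" where
  "simulated_past n 0 u = (\<lambda>_. 0)"
| "simulated_past n (Suc j) u =
     case_nat (\<phi> (simulated_past n j u) (u (n + int j + 1))) (simulated_past n j u)"

lemma measurable_simulated_past:
  assumes "\<And>k. k \<le> n + int j \<Longrightarrow> (\<lambda>x. snd x k) \<in> G \<rightarrow>\<^sub>M \<nu>"
  shows "(\<lambda>x. simulated_past n j (snd x)) \<in> G \<rightarrow>\<^sub>M S"
  using assms
proof (induction j)
  case (Suc j)
  have [measurable]: "(\<lambda>x. snd x (n + int j + 1)) \<in> G \<rightarrow>\<^sub>M \<nu>" by (rule Suc.prems) simp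
  have [measurable]: "(\<lambda>x. simulated_past n j (snd x)) \<in> G \<rightarrow>\<^sub>M S" by (rule Suc.IH, rule Suc.prems) simp
  show ?case by simp
qed (simp add: measurable_into_S)

text \<open>A martingale property: the pair of pasts is a function of the joint history, so the
  integral over \<nu> in \<open>discrepancy\<close> may be replaced by the actual next noise, and
  almost surely this noise moves the true past one step forward.\<close>

lemma nn_integral_discrepancy_step:
  "(\<integral>\<^sup>+x. discrepancy (Suc r) (simulated_past n j (snd x), past Y (n + int j) (fst x)) \<partial>enlarged)
   = (\<integral>\<^sup>+x. discrepancy r (simulated_past n (Suc j) (snd x), past Y (n + int (Suc j)) (fst x)) \<partial>enlarged)"
proof -
  let ?V = "\<lambda>x. (simulated_past n j (snd x), past Y (n + int j) (fst x))"
  let ?h = "\<lambda>(p, u). discrepancy r (case_nat (\<phi> (fst p) u) (fst p), case_nat (\<phi> (snd p) u) (snd p))"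
  have V: "?V \<in> joint_past (n + int j) \<rightarrow>\<^sub>M S \<Otimes>\<^sub>M S"
    by (intro measurable_Pair measurable_simulated_past measurable_joint_past_noise measurable_joint_past_past)
  have "?h \<in> borel_measurable ((S \<Otimes>\<^sub>M S) \<Otimes>\<^sub>M \<nu>)" by measurable
  from nn_integral_joint_past[OF V this]
  have "(\<integral>\<^sup>+x. discrepancy (Suc r) (?V x) \<partial>enlarged) = (\<integral>\<^sup>+x. ?h (?V x, snd x (n + int j + 1)) \<partial>enlarged)"
    by simp
  also have "\<dots> = (\<integral>\<^sup>+x. discrepancy r (simulated_past n (Suc j) (snd x), past Y (n + int (Suc j)) (fst x)) \<partial>enlarged)"
  proof (rule nn_integral_cong_AE, use AE_driven[of "n + int j"] in eventually_elim)
    case (elim x)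
    have "case_nat (\<phi> (past Y (n + int j) (fst x)) (snd x (n + int j + 1))) (past Y (n + int j) (fst x))
        = past Y (n + int j + 1) (fst x)"
      unfolding elim[symmetric] by (rule past_Suc)
    then show ?case by (simp add: add_ac)
  qed
  finally show ?thesis .
qed

lemma nn_integral_discrepancy:
  "(\<integral>\<^sup>+x. discrepancy (N - j) (simulated_past n j (snd x), past Y (n + int j) (fst x)) \<partial>enlarged)
   = (\<integral>\<^sup>+x. discrepancy N (simulated_past n 0 (snd x), past Y n (fst x)) \<partial>enlarged)" if "j \<le> N"
  using that
proof (induction j)
  case (Suc j)
  then have "N - j = Suc (N - Suc j)" by simp
  then show ?case using Suc nn_integral_discrepancy_step[of "N - Suc j" n j] by simp
qed simp

text \<open>The number \<open>l\<close> is only a lower bound for the length of agreement. Equal new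
  values raise it to \<open>Suc l\<close>; after a mismatch nothing is claimed and the induction
  hypothesis applies with 0.\<close>

lemma discrepancy_le_house_of_cards:
  fixes \<alpha> :: "nat \<Rightarrow> real"
  assumes alpha: "\<And>n. 0 \<le> \<alpha> n" "\<And>n. \<alpha> n \<le> 1" "decseq \<alpha>"
    and coupling: "\<And>s t l. (\<And>i. i < l \<Longrightarrow> s i = t i) \<Longrightarrow> measure \<nu> {u\<in>space \<nu>. \<phi> s u \<noteq> \<phi> t u} \<le> \<alpha> l"
  shows "(\<And>i. i < l \<Longrightarrow> s i = t i) \<Longrightarrow> discrepancy j (s, t) \<le> ennreal (house_of_cards \<alpha> j l)"
proof (induction j arbitrary: s t l)
  case 0
  then show ?case by (cases l) auto
next
  case (Suc j)
  let ?g = "house_of_cards \<alpha> j"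
  note g0 = house_of_cards_nonneg[OF alpha, of j]
  let ?D = "{u\<in>space \<nu>. \<phi> s u \<noteq> \<phi> t u}"
  have st: "s i = t i" if "i < l" for i using Suc.prems that .
  have [measurable]: "(\<lambda>u. \<phi> s u) \<in> \<nu> \<rightarrow>\<^sub>M count_space UNIV" for s by measurable
  have D[measurable]: "?D \<in> sets \<nu>" by measurable
  define d where "d = measure \<nu> ?D"
  have d: "d \<le> \<alpha> l" "0 \<le> d" "d \<le> 1"
    unfolding d_def using coupling[of l s t, OF st] by auto
  have "discrepancy (Suc j) (s, t)
      \<le> (\<integral>\<^sup>+u. ennreal (?g (Suc l)) * indicator (space \<nu> - ?D) u + ennreal (?g 0) * indicator ?D u \<partial>\<nu>)"
    unfolding discrepancy.simps
  proof (rule nn_integral_mono)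
    fix u assume u: "u \<in> space \<nu>"
    show "discrepancy j (case_nat (\<phi> (fst (s, t)) u) (fst (s, t)), case_nat (\<phi> (snd (s, t)) u) (snd (s, t)))
      \<le> ennreal (?g (Suc l)) * indicator (space \<nu> - ?D) u + ennreal (?g 0) * indicator ?D u"
    proof (cases "\<phi> s u = \<phi> t u")
      case True
      have "discrepancy j (case_nat (\<phi> t u) s, case_nat (\<phi> t u) t) \<le> ennreal (?g (Suc l))"
        by (rule Suc.IH) (auto simp: st split: nat.split)
      with True show ?thesis using u by simp
    next
      case False
      then show ?thesis
        using u Suc.IH[of 0 "case_nat (\<phi> s u) s" "case_nat (\<phi> t u) t"] by simp
    qed
  qed
  also have "\<dots> = ennreal (?g (Suc l)) * emeasure \<nu> (space \<nu> - ?D) + ennreal (?g 0) * emeasure \<nu> ?D"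
    by (subst nn_integral_add) (auto simp: nn_integral_cmult)
  also have "\<dots> = ennreal (?g (Suc l) * (1 - d) + ?g 0 * d)"
    unfolding nu.emeasure_eq_measure nu.prob_compl[OF D] d_def[symmetric]
    using g0 d by (simp add: ennreal_mult[symmetric] ennreal_plus[symmetric] del: ennreal_plus)
  also have "\<dots> \<le> ennreal (house_of_cards \<alpha> (Suc j) l)"
  proof (rule ennreal_leI)
    \<comment> \<open>Replacing the actual error \<open>d\<close> by the bound
      \<open>\<alpha> l\<close> shifts weight towards the larger value \<open>?g 0\<close>.\<close>
    have "(?g 0 - ?g (Suc l)) * d \<le> (?g 0 - ?g (Suc l)) * \<alpha> l"
      using house_of_cards_antimono[OF alpha, of 0 "Suc l" j] d by (intro mult_left_mono) auto
    then show "?g (Suc l) * (1 - d) + ?g 0 * d \<le> house_of_cards \<alpha> (Suc j) l"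
      by (simp add: algebra_simps)
  qed
  finally show ?case .
qed

section \<open>Assembling the generating parametrization\<close>

lemma generating_parametrization_enlarged:
  fixes \<alpha> :: "nat \<Rightarrow> real"
  assumes alpha: "\<And>n. 0 \<le> \<alpha> n" "\<And>n. \<alpha> n \<le> 1" "decseq \<alpha>"
    and diverges: "(\<Sum>k. ennreal (\<Prod>n=0..k. 1 - \<alpha> n)) = \<infinity>"
    and coupling: "\<And>s t l. (\<And>i. i < l \<Longrightarrow> s i = t i) \<Longrightarrow> measure \<nu> {u\<in>space \<nu>. \<phi> s u \<noteq> \<phi> t u} \<le> \<alpha> l"
  shows "generating_parametrization enlarged (count_space UNIV) (\<lambda>n. Y n \<circ> fst) \<nu> (\<lambda>n x. snd x n)"
proof -
  let ?Y = "\<lambda>n. Y n \<circ> fst" and ?U = "\<lambda>n x. snd x n :: nat \<Rightarrow> real"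
  let ?FY = "natural_filtration enlarged (count_space UNIV) ?Y"
  let ?FU = "natural_filtration enlarged \<nu> ?U"
  let ?FYU = "natural_filtration enlarged (count_space UNIV \<Otimes>\<^sub>M \<nu>) (\<lambda>k x. (?Y k x, ?U k x))"
  interpret cX: prob_space "completion enlarged" by (rule X.prob_space_completion)
  have U_space: "?U k \<in> space enlarged \<rightarrow> space \<nu>" for k
    using measurable_space[OF measurable_noise_component] by auto
  have U_FU: "?U k \<in> ?FU n \<rightarrow>\<^sub>M \<nu>" if "k \<le> n" for k n
    using measurable_natural_filtration[of ?U k enlarged \<nu> n] U_space that by simp
  have Y_FY: "?Y k \<in> ?FY n \<rightarrow>\<^sub>M count_space UNIV" if "k \<le> n" for k n
    using measurable_natural_filtration[of ?Y k enlarged "count_space UNIV" n] that by simp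

  have indep: "cX.indep_set (sets (vimage_algebra (space enlarged) (?U (n + 1)) \<nu>)) (sets (?FYU n))" for n
  proof (rule cX.indep_setI)
    show "sets (vimage_algebra (space enlarged) (?U (n + 1)) \<nu>) \<subseteq> sets (completion enlarged)"
      by (rule sets_image_in_sets) (auto intro: measurable_completion)
    show "sets (?FYU n) \<subseteq> sets (completion enlarged)"
    proof (rule sets_natural_filtration_subset)
      fix k
      have "(\<lambda>x. (?Y k x, ?U k x)) \<in> enlarged \<rightarrow>\<^sub>M count_space UNIV \<Otimes>\<^sub>M \<nu>" by measurable
      then show "(\<lambda>x. (?Y k x, ?U k x)) \<in> completion enlarged \<rightarrow>\<^sub>M count_space UNIV \<Otimes>\<^sub>M \<nu>"
        by (rule measurable_completion)
    qed (auto simp: null_sets_def)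
    fix A T assume A: "A \<in> sets (vimage_algebra (space enlarged) (?U (n + 1)) \<nu>)" and T: "T \<in> sets (?FYU n)"
    obtain D where D[measurable]: "D \<in> sets \<nu>" and A_eq: "A = ?U (n + 1) -` D \<inter> space enlarged"
      using A unfolding sets_vimage_algebra2[OF U_space] by auto
    have A'[measurable]: "A \<in> sets enlarged" unfolding A_eq by measurable
    have gen: "sigma_sets (space enlarged) (\<Union>k\<in>{..n}. sets (vimage_algebra (space enlarged)
        (\<lambda>x. (?Y k x, ?U k x)) (count_space UNIV \<Otimes>\<^sub>M \<nu>))) \<subseteq> sets (joint_past n)"
    proof (rule sets.sigma_sets_subset[of _ "joint_past n", simplified], safe)
      fix k V assume k: "k \<le> n" and
        V: "V \<in> sets (vimage_algebra (space enlarged) (\<lambda>x. (?Y k x, ?U k x)) (count_space UNIV \<Otimes>\<^sub>M \<nu>))"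
      have "(\<lambda>x. past Y n (fst x) (nat (n - k))) \<in> joint_past n \<rightarrow>\<^sub>M count_space UNIV"
        using measurable_compose[OF measurable_joint_past_past measurable_S_component] .
      then have "?Y k \<in> joint_past n \<rightarrow>\<^sub>M count_space UNIV"
        by (simp add: past_component[OF k] comp_def)
      then have "(\<lambda>x. (?Y k x, ?U k x)) \<in> joint_past n \<rightarrow>\<^sub>M count_space UNIV \<Otimes>\<^sub>M \<nu>"
        using measurable_joint_past_noise[OF k] by (rule measurable_Pair)
      then show "V \<in> sets (joint_past n)" using sets_image_in_sets[of "joint_past n"] V by auto
    qed
    \<comment> \<open>An event of the completed filtration is exchanged, up to a null set, for an
      event of the uncompleted joint past, where independence is already available.\<close>
    obtain T' where T': "T' \<in> sets (joint_past n)" and null: "sym_diff T T' \<in> null_sets (completion enlarged)"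
      using sigma_sets_Un_null_sets[OF T[unfolded sets_natural_filtration]] gen by blast
    have T'_sets[measurable]: "T' \<in> sets enlarged" using T' joint_past_subset by auto
    have T_sets: "T \<in> sets (completion enlarged)"
      using T \<open>sets (?FYU n) \<subseteq> sets (completion enlarged)\<close> by auto
    have ae: "AE x in completion enlarged. x \<in> T \<longleftrightarrow> x \<in> T'"
      by (rule AE_I'[OF null]) auto
    have "cX.prob (A \<inter> T) = cX.prob (A \<inter> T')"
    proof (rule measure_eq_AE)
      show "A \<inter> T \<in> sets (completion enlarged)" "A \<inter> T' \<in> sets (completion enlarged)"
        using T_sets A' T'_sets by (auto intro!: sets.Int)
    qed (use ae in auto)
    also have "\<dots> = X.prob {x\<in>T'. snd x (n + 1) \<in> D}"
    proof -
      have "A \<inter> T' = {x\<in>T'. snd x (n + 1) \<in> D}"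
        unfolding A_eq using sets.sets_into_space[OF T'_sets] by auto
      moreover have "A \<inter> T' \<in> sets enlarged" by measurable
      ultimately show ?thesis by (simp add: measure_completion)
    qed
    also have "\<dots> = X.prob T' * nu.prob D"
      using emeasure_joint_past_Int[OF T' D] by (simp add: measure_def enn2real_mult)
    also have "nu.prob D = cX.prob A"
    proof -
      have "A = {x\<in>space enlarged. snd x (n + 1) \<in> D}" unfolding A_eq by auto
      then show ?thesis
        using emeasure_joint_past_Int[OF sets.top[of "joint_past n"] D] A'
        by (simp add: measure_def X.emeasure_space_1)
    qed
    also have "X.prob T' = cX.prob T"
    proof -
      have "cX.prob T = cX.prob T'"
        using ae T_sets T'_sets by (intro measure_eq_AE) auto
      then show ?thesis by (simp only: measure_completion[OF T'_sets])
    qed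
    finally show "cX.prob (A \<inter> T) = cX.prob A * cX.prob T" by (simp add: mult.commute)
  qed

  have param: "?Y (n + 1) \<in> sigma (space enlarged)
      (sets (vimage_algebra (space enlarged) (?U (n + 1)) \<nu>) \<union> sets (?FY n)) \<rightarrow>\<^sub>M count_space UNIV" for n
  proof -
    define G where "G = sigma (space enlarged)
      (sets (vimage_algebra (space enlarged) (?U (n + 1)) \<nu>) \<union> sets (?FY n))"
    have sub: "sets (vimage_algebra (space enlarged) (?U (n + 1)) \<nu>) \<union> sets (?FY n) \<subseteq> Pow (space enlarged)"
      using sets.space_closed[of "vimage_algebra (space enlarged) (?U (n + 1)) \<nu>"] sets.space_closed[of "?FY n"]
      by simp
    have G: "sets G = sigma_sets (space enlarged)
        (sets (vimage_algebra (space enlarged) (?U (n + 1)) \<nu>) \<union> sets (?FY n))"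
      unfolding G_def using sub by (rule sets_measure_of)
    have space_G: "space G = space enlarged" unfolding G_def by (simp add: space_measure_of_conv)
    have FY_G: "sets (?FY n) \<subseteq> sets G" unfolding G by auto
    have [measurable]: "?U (n + 1) \<in> G \<rightarrow>\<^sub>M \<nu>"
    proof (rule measurableI)
      fix D assume "D \<in> sets \<nu>"
      then show "?U (n + 1) -` D \<inter> space G \<in> sets G"
        unfolding G space_G by (intro sigma_sets.Basic UnI1 in_vimage_algebra)
    qed (use U_space space_G in auto)
    have "?Y k \<in> G \<rightarrow>\<^sub>M count_space UNIV" if "k \<le> n" for k
      using Y_FY[OF that] FY_G space_G by (auto simp: measurable_def)
    then have [measurable]: "(\<lambda>x. past Y n (fst x)) \<in> G \<rightarrow>\<^sub>M S"
      by (intro measurable_into_S) (simp add: past_def comp_def)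
    have meas: "(\<lambda>x. \<phi> (past Y n (fst x)) (?U (n + 1) x)) \<in> G \<rightarrow>\<^sub>M count_space UNIV" by measurable
    have "AE x in enlarged. ?Y (n + 1) x = \<phi> (past Y n (fst x)) (?U (n + 1) x)"
      using AE_driven[of n] by (simp only: comp_def)
    \<comment> \<open>The driving equation holds only almost surely; the null sets contained in
      \<open>G\<close> absorb the difference.\<close>
    from measurable_AE_cong[OF space_G order_trans[OF null_sets_natural_filtration FY_G] meas this]
    show ?thesis unfolding G_def .
  qed

  have gen: "?Y n \<in> ?FU n \<rightarrow>\<^sub>M count_space UNIV" for n
  proof -
    have lim: "(\<lambda>N. house_of_cards \<alpha> N 0) \<longlonglongrightarrow> 0"
      by (rule house_of_cards_tendsto_0[OF alpha diverges])
    \<comment> \<open>Errors below \<open>(1/2) ^ i\<close> are summable, as Borel-Cantelli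
      requires.\<close>
    have "\<exists>N. house_of_cards \<alpha> N 0 < (1/2) ^ i" for i :: nat
      using order_tendstoD(2)[OF lim, of "(1/2) ^ i"] by (auto simp: eventually_sequentially)
    then obtain N where N: "\<And>i. house_of_cards \<alpha> (N i) 0 < (1/2) ^ i" by metis
    let ?Z = "\<lambda>i x. simulated_past (n - int (N i)) (N i) (snd x) 0"
    have Z_FU[measurable]: "?Z i \<in> ?FU n \<rightarrow>\<^sub>M count_space UNIV" for i
      by (rule measurable_compose[OF measurable_simulated_past measurable_S_component]) (rule U_FU, simp)
    have Z[measurable]: "?Z i \<in> enlarged \<rightarrow>\<^sub>M count_space UNIV" for i
      by (rule measurable_compose[OF measurable_simulated_past measurable_S_component]) measurable
    let ?A = "\<lambda>i. {x\<in>space enlarged. ?Z i x \<noteq> ?Y n x}"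
    have "?Y n \<in> enlarged \<rightarrow>\<^sub>M count_space UNIV" by measurable
    then have A[measurable]: "?A i \<in> sets enlarged" for i
      by (intro predE pred_intros_logic pred_eq_count_space Z)
    have A_le: "X.prob (?A i) \<le> (1/2) ^ i" for i
    proof -
      let ?n = "n - int (N i)"
      have "emeasure enlarged (?A i) = (\<integral>\<^sup>+x. indicator (?A i) x \<partial>enlarged)"
        by (rule nn_integral_indicator[OF A, symmetric])
      \<comment> \<open>With no step left, \<open>discrepancy\<close> is the indicator that the
        current values differ.\<close>
      also have "\<dots> = (\<integral>\<^sup>+x. discrepancy (N i - N i) (simulated_past ?n (N i) (snd x), past Y (?n + int (N i)) (fst x)) \<partial>enlarged)"
        by (intro nn_integral_cong) (auto simp: past_def)
      also have "\<dots> = (\<integral>\<^sup>+x. discrepancy (N i) (simulated_past ?n 0 (snd x), past Y ?n (fst x)) \<partial>enlarged)"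
        by (rule nn_integral_discrepancy) simp
      \<comment> \<open>The comparison is used with agreement length 0, so nothing is asked of the
        true past.\<close>
      also have "\<dots> \<le> (\<integral>\<^sup>+x. ennreal (house_of_cards \<alpha> (N i) 0) \<partial>enlarged)"
        by (intro nn_integral_mono discrepancy_le_house_of_cards[OF alpha coupling]) auto
      also have "\<dots> = ennreal (house_of_cards \<alpha> (N i) 0)" by (simp add: X.emeasure_space_1)
      finally have "X.prob (?A i) \<le> house_of_cards \<alpha> (N i) 0"
        by (simp add: X.emeasure_eq_measure house_of_cards_nonneg[OF alpha])
      with N[of i] show ?thesis by simp
    qed
    have "summable (\<lambda>i. X.prob (?A i))"
      by (rule summable_comparison_test'[of "\<lambda>i. (1/2) ^ i" 0]) (use A_le in auto)
    then have ae: "AE x in enlarged. eventually (\<lambda>i. x \<in> space enlarged - ?A i) sequentially"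
      by (intro borel_cantelli_AE1 A) (auto simp: X.emeasure_eq_measure)
    \<comment> \<open>Almost surely the simulated values are eventually constant, and then only one
      candidate remains; \<open>LEAST\<close> makes this limit a total function of the
      noises.\<close>
    let ?L = "\<lambda>x. LEAST a. \<exists>m. \<forall>i\<ge>m. ?Z i x = a"
    have "AE x in enlarged. ?Y n x = ?L x"
      using ae
    proof eventually_elim
      case (elim x)
      then obtain m where m: "\<And>i. i \<ge> m \<Longrightarrow> ?Z i x = ?Y n x"
        by (auto simp: eventually_sequentially)
      show "?Y n x = ?L x"
      proof (rule sym, rule Least_equality)
        show "\<exists>m. \<forall>i\<ge>m. ?Z i x = ?Y n x" using m by blast
        fix a assume "\<exists>m. \<forall>i\<ge>m. ?Z i x = a"
        then obtain m' where "\<forall>i\<ge>m'. ?Z i x = a" by blast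
        then show "?Y n x \<le> a" using m[of "max m m'"] by simp
      qed
    qed
    moreover have "?L \<in> ?FU n \<rightarrow>\<^sub>M count_space UNIV" by measurable
    ultimately show ?thesis
      by (rule measurable_AE_cong[OF space_natural_filtration null_sets_natural_filtration, rotated])
  qed

  show ?thesis
    unfolding generating_parametrization_def parametrization_def
    using indep param gen by (auto intro: measurable_completion)
qed

end

section \<open>Coding of finite state spaces and influence\<close>

text \<open>Singletons need not be events, so the codes number the atoms. An atom is an event
  because it is an intersection of finitely many events, and \<open>rep\<close> chooses a point in
  each; numbers that code no atom receive an arbitrary point.\<close>

lemma finite_space_coding:
  assumes fin: "finite (space E)" and ne: "space E \<noteq> {}"
  obtains c :: "'e \<Rightarrow> nat" and rep where
    "c \<in> E \<rightarrow>\<^sub>M count_space UNIV" "\<And>e. e \<in> space E \<Longrightarrow> c e < card (space E)" "\<And>a. rep a \<in> space E"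
    "\<And>A e. A \<in> sets E \<Longrightarrow> e \<in> space E \<Longrightarrow> rep (c e) \<in> A \<longleftrightarrow> e \<in> A"
proof -
  define atom where "atom e = space E \<inter> \<Inter>{A \<in> sets E. e \<in> A}" for e
  have fin_sets: "finite (sets E)"
    by (rule finite_subset[OF sets.space_closed]) (simp add: fin)
  have atom_sets: "atom e \<in> sets E" if "e \<in> space E" for e
  proof -
    have "(\<Inter>A\<in>{A \<in> sets E. e \<in> A}. A) \<in> sets E"
    proof (rule sets.finite_INT)
      show "finite {A \<in> sets E. e \<in> A}" using fin_sets by (rule rev_finite_subset) blast
      show "{A \<in> sets E. e \<in> A} \<noteq> {}" using that sets.top by blast
    qed blast
    then show ?thesis unfolding atom_def by (intro sets.Int sets.top) simp
  qed
  have atom_iff: "e \<in> A \<longleftrightarrow> e' \<in> A" if "e' \<in> atom e" "e \<in> space E" "A \<in> sets E" for e e' A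
  proof (cases "e \<in> A")
    case True
    then show ?thesis using that by (simp add: atom_def)
  next
    case False
    then have "e' \<in> space E - A"
      using that(1,2) sets.compl_sets[OF that(3)] unfolding atom_def by blast
    with False show ?thesis by simp
  qed
  let ?Q = "atom ` space E"
  have "finite ?Q" using fin by simp
  then obtain b where b: "bij_betw b ?Q {0..<card ?Q}" using ex_bij_betw_finite_nat by blast
  define c where "c e = b (atom e)" for e
  have "\<exists>e'\<in>space E. (\<exists>e\<in>space E. c e = a) \<longrightarrow> c e' = a" for a using ne by blast
  then obtain rep where rep: "\<And>a. rep a \<in> space E" and "\<And>a. (\<exists>e\<in>space E. c e = a) \<longrightarrow> c (rep a) = a"
    by metis
  then have c_rep: "c (rep (c e)) = c e" if "e \<in> space E" for e using that by blast
  show thesis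
  proof
    show "c \<in> E \<rightarrow>\<^sub>M count_space UNIV"
    proof (rule measurableI)
      fix V :: "nat set"
      have "c -` V \<inter> space E = (\<Union>e\<in>{e\<in>space E. c e \<in> V}. atom e)"
      proof (intro equalityI subsetI)
        fix e' assume "e' \<in> (\<Union>e\<in>{e\<in>space E. c e \<in> V}. atom e)"
        then obtain e where e: "e \<in> space E" "c e \<in> V" "e' \<in> atom e" by blast
        then have e': "e' \<in> space E" by (auto simp: atom_def)
        have "{A \<in> sets E. e' \<in> A} = {A \<in> sets E. e \<in> A}" using atom_iff[OF e(3,1)] by blast
        then have "atom e' = atom e" by (simp only: atom_def)
        with e e' show "e' \<in> c -` V \<inter> space E" by (simp add: c_def)
      qed (auto simp: atom_def)
      also have "\<dots> \<in> sets E" using fin atom_sets by (intro sets.finite_UN) auto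
      finally show "c -` V \<inter> space E \<in> sets E" .
    qed simp
    show "c e < card (space E)" if "e \<in> space E" for e
    proof -
      have "c e < card ?Q" using bij_betwE[OF b] that by (auto simp: c_def)
      then show ?thesis using card_image_le[OF fin, of atom] by simp
    qed
    show "rep (c e) \<in> A \<longleftrightarrow> e \<in> A" if "A \<in> sets E" "e \<in> space E" for A e
    proof -
      have "atom (rep (c e)) = atom e"
        using inj_onD[OF bij_betw_imp_inj_on[OF b], of "atom (rep (c e))" "atom e"] c_rep[OF that(2)] rep that(2)
        by (simp add: c_def)
      moreover have "e \<in> atom e" using that(2) by (auto simp: atom_def)
      ultimately show ?thesis using atom_iff[OF _ rep that(1)] by simp
    qed
  qed (rule rep)
qed

text \<open>Each event of \<open>E\<close> is the preimage under \<open>c\<close> of the codes whose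
  representative lies in it, so \<open>X n\<close> and its code carry the same information.
  Independence uses that the joint filtration of \<open>X\<close> lies in the coded one, and
  condition (ii) uses the converse inclusion for the process alone.\<close>

lemma generating_parametrization_coding:
  assumes gp: "generating_parametrization M (count_space UNIV) (\<lambda>n. c \<circ> X n) N U"
    and M: "prob_space M" and X: "\<And>n. X n \<in> M \<rightarrow>\<^sub>M E" and c: "c \<in> E \<rightarrow>\<^sub>M count_space UNIV"
    and rep: "\<And>A e. A \<in> sets E \<Longrightarrow> e \<in> space E \<Longrightarrow> rep (c e) \<in> A \<longleftrightarrow> e \<in> A"
  shows "generating_parametrization M E X N U"
proof -
  interpret prob_space "completion M" by (rule prob_space.prob_space_completion[OF M])
  let ?Y = "\<lambda>n. c \<circ> X n"
  have U: "U n \<in> completion M \<rightarrow>\<^sub>M N"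
    and indep: "indep_set (sets (vimage_algebra (space M) (U (n + 1)) N))
        (sets (natural_filtration M (count_space UNIV \<Otimes>\<^sub>M N) (\<lambda>k \<omega>. (?Y k \<omega>, U k \<omega>)) n))"
    and param: "?Y (n + 1) \<in> sigma (space M) (sets (vimage_algebra (space M) (U (n + 1)) N) \<union>
        sets (natural_filtration M (count_space UNIV) ?Y n)) \<rightarrow>\<^sub>M count_space UNIV"
    and gen: "?Y n \<in> natural_filtration M N U n \<rightarrow>\<^sub>M count_space UNIV" for n
    using gp unfolding generating_parametrization_def parametrization_def by auto
  have U_space: "U n \<in> space M \<rightarrow> space N" for n using measurable_space[OF U] by auto
  have X_space: "X n \<in> space M \<rightarrow> space E" for n using measurable_space[OF X] by auto
  have decode: "X n \<in> G \<rightarrow>\<^sub>M E" if G: "space G = space M" and Y: "?Y n \<in> G \<rightarrow>\<^sub>M count_space UNIV" for G n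
  proof (rule measurableI)
    fix A assume A: "A \<in> sets E"
    have "X n -` A \<inter> space G = ?Y n -` {a. rep a \<in> A} \<inter> space G"
      using rep[OF A] X_space[of n] G by auto
    also have "\<dots> \<in> sets G" by (rule measurable_sets[OF Y]) simp
    finally show "X n -` A \<inter> space G \<in> sets G" .
  qed (use X_space G in auto)
  have "indep_set (sets (vimage_algebra (space M) (U (n + 1)) N))
        (sets (natural_filtration M (E \<Otimes>\<^sub>M N) (\<lambda>k \<omega>. (X k \<omega>, U k \<omega>)) n))" for n
  proof -
    let ?G = "natural_filtration M (count_space UNIV \<Otimes>\<^sub>M N) (\<lambda>k \<omega>. (?Y k \<omega>, U k \<omega>)) n"
    have "sets (natural_filtration M (E \<Otimes>\<^sub>M N) (\<lambda>k \<omega>. (X k \<omega>, U k \<omega>)) n) \<subseteq> sets ?G"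
    proof (rule sets_natural_filtration_subset)
      fix k assume k: "k \<le> n"
      have pair: "(\<lambda>\<omega>. (?Y k \<omega>, U k \<omega>)) \<in> ?G \<rightarrow>\<^sub>M count_space UNIV \<Otimes>\<^sub>M N"
        by (rule measurable_natural_filtration[OF _ k]) (use U_space in \<open>auto simp: space_pair_measure\<close>)
      have "?Y k \<in> ?G \<rightarrow>\<^sub>M count_space UNIV" "U k \<in> ?G \<rightarrow>\<^sub>M N"
        using measurable_compose[OF pair measurable_fst] measurable_compose[OF pair measurable_snd]
        by (simp_all add: comp_def)
      then show "(\<lambda>\<omega>. (X k \<omega>, U k \<omega>)) \<in> ?G \<rightarrow>\<^sub>M E \<Otimes>\<^sub>M N"
        by (intro measurable_Pair decode) auto
    qed (simp_all add: null_sets_natural_filtration)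
    with indep[of n] show ?thesis
      by (intro indep_setI indep_setD_ev1[OF indep] order_trans[OF _ indep_setD_ev2[OF indep]] indep_setD[OF indep]) auto
  qed
  moreover have "X (n + 1) \<in> sigma (space M) (sets (vimage_algebra (space M) (U (n + 1)) N) \<union>
        sets (natural_filtration M E X n)) \<rightarrow>\<^sub>M E" for n
  proof (rule decode)
    have "sets (natural_filtration M (count_space UNIV) ?Y n) \<subseteq> sets (natural_filtration M E X n)"
    proof (rule sets_natural_filtration_subset)
      fix k assume "k \<le> n"
      then have "X k \<in> natural_filtration M E X n \<rightarrow>\<^sub>M E" by (intro measurable_natural_filtration X_space)
      then show "?Y k \<in> natural_filtration M E X n \<rightarrow>\<^sub>M count_space UNIV" using c by (rule measurable_comp)
    qed (simp_all add: null_sets_natural_filtration)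
    moreover have sub: "sets (vimage_algebra (space M) (U (n + 1)) N) \<union> sets (natural_filtration M F Z n) \<subseteq> Pow (space M)" for F :: "'z measure" and Z
      using sets.space_closed[of "vimage_algebra (space M) (U (n + 1)) N"] sets.space_closed[of "natural_filtration M F Z n"]
      by simp
    ultimately have "sets (sigma (space M) (sets (vimage_algebra (space M) (U (n + 1)) N) \<union> sets (natural_filtration M (count_space UNIV) ?Y n)))
        \<subseteq> sets (sigma (space M) (sets (vimage_algebra (space M) (U (n + 1)) N) \<union> sets (natural_filtration M E X n)))"
      unfolding sets_measure_of[OF sub] by (intro sigma_sets_mono' Un_mono order_refl)
    then show "?Y (n + 1) \<in> sigma (space M) (sets (vimage_algebra (space M) (U (n + 1)) N) \<union>
        sets (natural_filtration M E X n)) \<rightarrow>\<^sub>M count_space UNIV"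
      using measurable_sets[OF param[of n]] by (intro measurableI) (auto simp: space_measure_of_conv)
  qed (simp add: space_measure_of_conv)
  moreover have "X n \<in> natural_filtration M N U n \<rightarrow>\<^sub>M E" for n
    by (rule decode[OF _ gen]) simp
  ultimately show ?thesis
    unfolding generating_parametrization_def parametrization_def using U by blast
qed

section \<open>Conditional densities and the influence sequence\<close>

lemma past_append_Cons: "past_append x (e # z) = past_append (past_append x [e]) z"
proof
  fix j show "past_append x (e # z) j = past_append (past_append x [e]) z j"
    by (cases "j < length z"; cases "j = length z")
       (auto simp: past_append_def nth_append Suc_diff_Suc)
qed

lemma past_append_map_rev: "past_append (\<lambda>i. s (i + l)) (map s (rev [0..<l])) = s"
  by (auto simp: past_append_def fun_eq_iff rev_map)

context
  fixes \<pi> :: "'e measure" and \<kappa> :: "(nat \<Rightarrow> 'e) \<Rightarrow> 'e measure" and f :: "(nat \<Rightarrow> 'e) \<Rightarrow> 'e \<Rightarrow> real"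
  assumes kappa_prob: "\<And>x. x \<in> space (past_space \<pi>) \<Longrightarrow> prob_space (\<kappa> x)"
    and f_meas: "\<And>x. x \<in> space (past_space \<pi>) \<Longrightarrow> f x \<in> borel_measurable \<pi>"
    and f_nonneg: "\<And>x e. x \<in> space (past_space \<pi>) \<Longrightarrow> e \<in> space \<pi> \<Longrightarrow> 0 \<le> f x e"
    and kappa_density: "\<And>x. x \<in> space (past_space \<pi>) \<Longrightarrow> \<kappa> x = density \<pi> (\<lambda>e. ennreal (f x e))"
    and space_ne: "space \<pi> \<noteq> {}"
begin

lemma space_past_space: "space (past_space E) = {x. \<forall>i. x i \<in> space E}"
  by (auto simp: past_space_def space_PiM)

lemma conditional_density_integral:
  assumes x: "x \<in> space (past_space \<pi>)"
  shows "integrable \<pi> (f x)" "integral\<^sup>L \<pi> (f x) = 1"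
    "A \<in> sets \<pi> \<Longrightarrow> measure (\<kappa> x) A = (\<integral>e. indicator A e * f x e \<partial>\<pi>)"
proof -
  have ae: "AE e in \<pi>. 0 \<le> f x e" using f_nonneg[OF x] by auto
  have "(\<integral>\<^sup>+e. ennreal (f x e) \<partial>\<pi>) = emeasure (\<kappa> x) (space (\<kappa> x))"
    unfolding kappa_density[OF x] using f_meas[OF x]
    by (subst emeasure_density) (auto intro!: nn_integral_cong)
  then have 1: "(\<integral>\<^sup>+e. ennreal (f x e) \<partial>\<pi>) = 1"
    using prob_space.emeasure_space_1[OF kappa_prob[OF x]] by simp
  show "integrable \<pi> (f x)"
    by (rule integrableI_nonneg) (use f_meas[OF x] ae 1 in auto)
  show "integral\<^sup>L \<pi> (f x) = 1"
    by (subst integral_eq_nn_integral) (use f_meas[OF x] ae 1 in auto)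
  show "measure (\<kappa> x) A = (\<integral>e. indicator A e * f x e \<partial>\<pi>)" if A: "A \<in> sets \<pi>"
  proof -
    have "(\<integral>e. indicator A e * f x e \<partial>\<pi>) = enn2real (\<integral>\<^sup>+e. ennreal (indicator A e * f x e) \<partial>\<pi>)"
      by (rule integral_eq_nn_integral) (use f_meas[OF x] A f_nonneg[OF x] in auto)
    also have "(\<integral>\<^sup>+e. ennreal (indicator A e * f x e) \<partial>\<pi>) = emeasure (\<kappa> x) A"
      unfolding kappa_density[OF x] using f_meas[OF x] A
      by (subst emeasure_density) (auto intro!: nn_integral_cong simp: indicator_def)
    finally show ?thesis by (simp add: measure_def)
  qed
qed

lemma density_dist_bounds:
  assumes "x \<in> space (past_space \<pi>)" "y \<in> space (past_space \<pi>)"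
  shows "0 \<le> density_dist \<pi> (f x) (f y)" "density_dist \<pi> (f x) (f y) \<le> 1"
proof -
  note x = conditional_density_integral[OF assms(1)] and y = conditional_density_integral[OF assms(2)]
  show "0 \<le> density_dist \<pi> (f x) (f y)" unfolding density_dist_def by simp
  have "(\<integral>e. \<bar>f x e - f y e\<bar> \<partial>\<pi>) \<le> (\<integral>e. f x e + f y e \<partial>\<pi>)"
    using x y f_nonneg[OF assms(1)] f_nonneg[OF assms(2)]
    by (intro integral_mono) (auto intro!: abs_leI simp: algebra_simps add_increasing add_increasing2)
  also have "\<dots> = 2" using x y by simp
  finally show "density_dist \<pi> (f x) (f y) \<le> 1" unfolding density_dist_def by simp
qed

text \<open>Coding merges points, which cannot increase the distance: on each fibre the integral of
  the difference is bounded by that of its absolute value, and the fibres are disjoint.\<close>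

lemma total_variation_le_density_dist:
  assumes x: "x \<in> space (past_space \<pi>)" and y: "y \<in> space (past_space \<pi>)"
    and c: "c \<in> \<pi> \<rightarrow>\<^sub>M count_space (UNIV :: nat set)"
  shows "(\<Sum>a<m. \<bar>measure (\<kappa> x) {e\<in>space \<pi>. c e = a} - measure (\<kappa> y) {e\<in>space \<pi>. c e = a}\<bar>) / 2
    \<le> density_dist \<pi> (f x) (f y)"
proof -
  note [measurable] = c
  let ?A = "\<lambda>a. {e\<in>space \<pi>. c e = a}"
  note fx = conditional_density_integral[OF x] and fy = conditional_density_integral[OF y]
  have int: "integrable \<pi> (\<lambda>e. indicator (?A a) e * f x e)" "integrable \<pi> (\<lambda>e. indicator (?A a) e * f y e)"
    "integrable \<pi> (\<lambda>e. indicator (?A a) e * \<bar>f x e - f y e\<bar>)" for a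
    using fx(1) fy(1) by (auto intro!: integrable_real_mult_indicator simp: mult.commute[of "indicator _ _"])
  have "\<bar>measure (\<kappa> x) (?A a) - measure (\<kappa> y) (?A a)\<bar> \<le> (\<integral>e. indicator (?A a) e * \<bar>f x e - f y e\<bar> \<partial>\<pi>)" for a
  proof -
    have "measure (\<kappa> x) (?A a) - measure (\<kappa> y) (?A a) = (\<integral>e. indicator (?A a) e * f x e - indicator (?A a) e * f y e \<partial>\<pi>)"
      using int by (simp add: fx(3) fy(3))
    also have "\<bar>\<dots>\<bar> \<le> (\<integral>e. \<bar>indicator (?A a) e * f x e - indicator (?A a) e * f y e\<bar> \<partial>\<pi>)"
      by (rule integral_abs_bound)
    also have "\<dots> = (\<integral>e. indicator (?A a) e * \<bar>f x e - f y e\<bar> \<partial>\<pi>)"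
      by (intro Bochner_Integration.integral_cong) (auto simp: indicator_def)
    finally show ?thesis .
  qed
  then have "(\<Sum>a<m. \<bar>measure (\<kappa> x) (?A a) - measure (\<kappa> y) (?A a)\<bar>)
      \<le> (\<Sum>a<m. \<integral>e. indicator (?A a) e * \<bar>f x e - f y e\<bar> \<partial>\<pi>)" by (rule sum_mono)
  also have "\<dots> = (\<integral>e. (\<Sum>a<m. indicator (?A a) e * \<bar>f x e - f y e\<bar>) \<partial>\<pi>)"
    by (rule Bochner_Integration.integral_sum[symmetric]) (rule int(3))
  also have "\<dots> \<le> (\<integral>e. \<bar>f x e - f y e\<bar> \<partial>\<pi>)"
  proof (rule integral_mono)
    fix e assume "e \<in> space \<pi>"
    then have "(\<Sum>a<m. indicator (?A a) e * \<bar>f x e - f y e\<bar>) = (\<Sum>a<m. if a = c e then \<bar>f x e - f y e\<bar> else 0)"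
      by (intro sum.cong) (auto simp: indicator_def)
    then show "(\<Sum>a<m. indicator (?A a) e * \<bar>f x e - f y e\<bar>) \<le> \<bar>f x e - f y e\<bar>" by simp
  next
    show "integrable \<pi> (\<lambda>e. \<Sum>a<m. indicator (?A a) e * \<bar>f x e - f y e\<bar>)"
      by (rule Bochner_Integration.integrable_sum) (rule int(3))
    show "integrable \<pi> (\<lambda>e. \<bar>f x e - f y e\<bar>)" using fx fy by auto
  qed
  finally show ?thesis unfolding density_dist_def by simp
qed

text \<open>Named because a real supremum is meaningful only once the set is known to be nonempty
  and bounded.\<close>

definition influence_set :: "nat \<Rightarrow> real set" where
  "influence_set n = {density_dist \<pi> (f (past_append x z)) (f (past_append y z)) | x y z.
            x \<in> space (past_space \<pi>) \<and> y \<in> space (past_space \<pi>) \<and> set z \<subseteq> space \<pi> \<and> length z = n}"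

lemma past_append_space:
  assumes "x \<in> space (past_space \<pi>)" "set z \<subseteq> space \<pi>"
  shows "past_append x z \<in> space (past_space \<pi>)"
proof -
  have "rev z ! j \<in> space \<pi>" if "j < length z" for j
    using assms(2) that nth_mem[of j "rev z"] by auto
  then show ?thesis using assms(1) by (auto simp: space_past_space past_append_def)
qed

lemma influence_set_bounds: "influence_set n \<subseteq> {0..1}"
  unfolding influence_set_def using density_dist_bounds past_append_space by auto

lemma influence_set_nonempty: "influence_set n \<noteq> {}"
proof -
  obtain e where e: "e \<in> space \<pi>" using space_ne by blast
  then have "density_dist \<pi> (f (past_append (\<lambda>_. e) (replicate n e))) (f (past_append (\<lambda>_. e) (replicate n e))) \<in> influence_set n"
    unfolding influence_set_def by (force simp: space_past_space)
  then show ?thesis by blast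
qed

lemma influence_eq: "influence \<pi> f n = Sup (influence_set n)"
  unfolding influence_def influence_set_def ..

lemma bdd_above_influence_set: "bdd_above (influence_set n)"
  using influence_set_bounds by (rule bdd_above_mono[rotated]) simp

lemma influence_bounds: "0 \<le> influence \<pi> f n" "influence \<pi> f n \<le> 1"
proof -
  obtain d where d: "d \<in> influence_set n" using influence_set_nonempty by blast
  then have "0 \<le> d" using influence_set_bounds[of n] by auto
  also have "d \<le> influence \<pi> f n" unfolding influence_eq by (rule cSup_upper[OF d bdd_above_influence_set])
  finally show "0 \<le> influence \<pi> f n" .
  show "influence \<pi> f n \<le> 1"
    unfolding influence_eq using influence_set_bounds[of n] by (intro cSup_least[OF influence_set_nonempty]) auto
qed

lemma influence_decseq: "decseq (influence \<pi> f)"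
proof (rule decseq_SucI)
  fix n
  have "influence_set (Suc n) \<subseteq> influence_set n"
  proof
    fix d assume "d \<in> influence_set (Suc n)"
    then obtain x y e z where d: "d = density_dist \<pi> (f (past_append x (e # z))) (f (past_append y (e # z)))"
      "x \<in> space (past_space \<pi>)" "y \<in> space (past_space \<pi>)" "e \<in> space \<pi>" "set z \<subseteq> space \<pi>" "length z = n"
      unfolding influence_set_def by (auto simp: length_Suc_conv)
    then have "past_append x [e] \<in> space (past_space \<pi>)" "past_append y [e] \<in> space (past_space \<pi>)"
      using past_append_space by auto
    then show "d \<in> influence_set n"
      unfolding influence_set_def d(1) past_append_Cons[of _ e z] using d(5,6) by blast
  qed
  then show "influence \<pi> f (Suc n) \<le> influence \<pi> f n"
    unfolding influence_eq by (intro cSup_subset_mono influence_set_nonempty bdd_above_influence_set)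
qed

lemma density_dist_le_influence:
  assumes x: "x \<in> space (past_space \<pi>)" and y: "y \<in> space (past_space \<pi>)" and eq: "\<And>i. i < l \<Longrightarrow> x i = y i"
  shows "density_dist \<pi> (f x) (f y) \<le> influence \<pi> f l"
proof -
  \<comment> \<open>The last \<open>l\<close> entries in chronological order, hence reversed with
    respect to the encoding of pasts.\<close>
  let ?z = "map x (rev [0..<l])"
  have z: "?z = map y (rev [0..<l])" using eq by simp
  have "density_dist \<pi> (f (past_append (\<lambda>i. x (i + l)) ?z)) (f (past_append (\<lambda>i. y (i + l)) ?z)) \<in> influence_set l"
    unfolding influence_set_def using x y by (auto simp: space_past_space intro!: exI)
  then have "density_dist \<pi> (f x) (f y) \<in> influence_set l"
    using past_append_map_rev[of y l] unfolding z[symmetric] by (simp add: past_append_map_rev)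
  then show ?thesis unfolding influence_eq by (rule cSup_upper[OF _ bdd_above_influence_set])
qed

end

section \<open>The criterion\<close>

lemma stationary_processD:
  assumes "stationary_process M E X"
  shows "X k \<in> M \<rightarrow>\<^sub>M E"
    "h \<in> borel_measurable (PiM UNIV (\<lambda>_. E)) \<Longrightarrow>
      (\<integral>\<^sup>+\<omega>. h (\<lambda>k. X (k + m) \<omega>) \<partial>M) = (\<integral>\<^sup>+\<omega>. h (\<lambda>k. X k \<omega>) \<partial>M)"
proof -
  show X: "X k \<in> M \<rightarrow>\<^sub>M E" for k using assms by (auto simp: stationary_process_def)
  assume h: "h \<in> borel_measurable (PiM UNIV (\<lambda>_. E))"
  have shift: "(\<lambda>\<omega> k. X (k + m) \<omega>) \<in> M \<rightarrow>\<^sub>M PiM UNIV (\<lambda>_. E)" for m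
    using measurable_space[OF X] by (intro measurable_PiM_single' X) auto
  have "(\<integral>\<^sup>+\<omega>. h (\<lambda>k. X (k + m) \<omega>) \<partial>M) = (\<integral>\<^sup>+\<xi>. h \<xi> \<partial>distr M (PiM UNIV (\<lambda>_. E)) (\<lambda>\<omega> k. X (k + m) \<omega>))"
    by (rule nn_integral_distr[OF shift, symmetric]) (simp add: h)
  also have "\<dots> = (\<integral>\<^sup>+\<xi>. h \<xi> \<partial>distr M (PiM UNIV (\<lambda>_. E)) (\<lambda>\<omega> k. X k \<omega>))"
    using assms by (simp add: stationary_process_def)
  also have "\<dots> = (\<integral>\<^sup>+\<omega>. h (\<lambda>k. X k \<omega>) \<partial>M)"
    using nn_integral_distr[OF shift[of 0], of h] h by simp
  finally show "(\<integral>\<^sup>+\<omega>. h (\<lambda>k. X (k + m) \<omega>) \<partial>M) = (\<integral>\<^sup>+\<omega>. h (\<lambda>k. X k \<omega>) \<partial>M)" .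
qed

text \<open>The product sigma-field cannot distinguish a past from the past of its representatives:
  this holds for sets fixing one coordinate and survives complements and countable unions.\<close>

lemma past_space_coding_iff:
  assumes rep: "\<And>a. rep a \<in> space E" "\<And>A e. A \<in> sets E \<Longrightarrow> e \<in> space E \<Longrightarrow> rep (c e) \<in> A \<longleftrightarrow> e \<in> A"
    and T: "T \<in> sets (past_space E)" and x: "x \<in> space (past_space E)"
  shows "(\<lambda>i. rep (c (x i))) \<in> T \<longleftrightarrow> x \<in> T"
  using T x unfolding past_space_def sets_PiM_single
proof (induction arbitrary: x)
  case (Basic T)
  then obtain i A where "T = {f \<in> \<Pi>\<^sub>E i\<in>UNIV. space E. f i \<in> A}" "A \<in> sets E" by blast
  with Basic rep show ?case by (auto simp: space_PiM PiE_iff)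
next
  case (Compl T)
  then show ?case using rep(1) by (auto simp: space_PiM PiE_iff)
qed auto

text \<open>The conditional law is given only at time 0 and for the true past. Stationarity carries
  it to every time, and evaluating \<open>\<kappa>\<close> at representatives makes it a function of
  the coded past.\<close>

lemma coded_cond_law:
  assumes M: "prob_space M" and X: "stationary_process M \<pi> X"
    and \<kappa>: "regular_conditional_law M \<pi> (X 0) (past_space \<pi>) (past X (-1)) \<kappa>"
    and c[measurable]: "c \<in> \<pi> \<rightarrow>\<^sub>M count_space (UNIV :: nat set)"
    and rep: "\<And>a. rep a \<in> space \<pi>" "\<And>A e. A \<in> sets \<pi> \<Longrightarrow> e \<in> space \<pi> \<Longrightarrow> rep (c e) \<in> A \<longleftrightarrow> e \<in> A"
    and B[measurable]: "B \<in> sets (past_space (count_space UNIV))"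
  shows "emeasure M {\<omega>\<in>space M. past (\<lambda>n. c \<circ> X n) n \<omega> \<in> B \<and> (c \<circ> X (n + 1)) \<omega> = a} =
      (\<integral>\<^sup>+\<omega>. indicator B (past (\<lambda>n. c \<circ> X n) n \<omega>) *
        ennreal (measure (\<kappa> (\<lambda>i. rep (past (\<lambda>n. c \<circ> X n) n \<omega> i))) {e\<in>space \<pi>. c e = a}) \<partial>M)"
proof -
  interpret prob_space M by (rule M)
  let ?S = "past_space (count_space (UNIV :: nat set))" and ?A = "{e\<in>space \<pi>. c e = a}"
  let ?Y = "\<lambda>n. c \<circ> X n" and ?P = "PiM UNIV (\<lambda>_::int. \<pi>)"
  let ?q = "\<lambda>s. ennreal (measure (\<kappa> (\<lambda>i. rep (s i))) ?A)"
  have Xm[measurable]: "X k \<in> M \<rightarrow>\<^sub>M \<pi>" for k using stationary_processD(1)[OF X] .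
  have A[measurable]: "?A \<in> sets \<pi>" by measurable
  have kappa[measurable]: "\<kappa> \<in> past_space \<pi> \<rightarrow>\<^sub>M prob_algebra \<pi>"
    and cond: "AE \<omega> in M. real_cond_exp M (vimage_algebra (space M) (past X (-1)) (past_space \<pi>))
        (\<lambda>\<omega>. indicator ?A (X 0 \<omega>)) \<omega> = measure (\<kappa> (past X (-1) \<omega>)) ?A"
    using \<kappa> A unfolding regular_conditional_law_def by blast+
  have lift: "(\<lambda>s i. rep (s i)) \<in> ?S \<rightarrow>\<^sub>M past_space \<pi>"
    unfolding past_space_def using rep(1) by (intro measurable_PiM_single') (auto simp: space_PiM)
  have q[measurable]: "?q \<in> borel_measurable ?S"
    using measurable_compose[OF lift measurable_compose[OF kappa measurable_measure_prob_algebra[OF A]]] by simp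
  have pastX[measurable]: "past X k \<in> M \<rightarrow>\<^sub>M past_space \<pi>" for k
    unfolding past_space_def past_def using measurable_space[OF Xm]
    by (intro measurable_PiM_single' Xm) auto
  have code: "(\<lambda>x i. c (x i)) \<in> past_space \<pi> \<rightarrow>\<^sub>M ?S"
    unfolding past_space_def by (intro measurable_PiM_single') (auto simp: space_PiM)
  have pastY: "past ?Y k \<omega> = (\<lambda>i. c (past X k \<omega> i))" for k \<omega>
    by (simp add: past_def fun_eq_iff)
  have pastYm[measurable]: "past ?Y k \<in> M \<rightarrow>\<^sub>M ?S" for k
    using measurable_compose[OF pastX code, of k] by (simp add: pastY[abs_def])

  have kappa_code: "measure (\<kappa> (\<lambda>i. rep (c (x i)))) ?A = measure (\<kappa> x) ?A" if x: "x \<in> space (past_space \<pi>)" for x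
  proof -
    \<comment> \<open>The level set of this probability through \<open>x\<close> is an event, so it
      contains the past of representatives as well.\<close>
    have "(\<lambda>y. measure (\<kappa> y) ?A) -` {measure (\<kappa> x) ?A} \<inter> space (past_space \<pi>) \<in> sets (past_space \<pi>)"
      by (rule measurable_sets[OF measurable_compose[OF kappa measurable_measure_prob_algebra[OF A]]]) simp
    from past_space_coding_iff[where rep = rep and c = c, OF rep this x] x show ?thesis by simp
  qed

  let ?trace = "\<lambda>\<xi> (i::nat). c (\<xi> (- 1 - int i)) :: nat"
  have trace[measurable]: "?trace \<in> ?P \<rightarrow>\<^sub>M ?S"
    unfolding past_space_def by (intro measurable_PiM_single') (auto simp: space_PiM)
  have trace_Y: "?trace (\<lambda>k. X (k + (n + 1)) \<omega>) = past ?Y n \<omega>" for n \<omega>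
    by (simp add: past_def fun_eq_iff algebra_simps)
  have shift: "(\<integral>\<^sup>+\<omega>. g (past ?Y n \<omega>) (X (n + 1) \<omega>) \<partial>M) = (\<integral>\<^sup>+\<omega>. g (past ?Y (-1) \<omega>) (X 0 \<omega>) \<partial>M)"
    if g: "(\<lambda>\<xi>. g (?trace \<xi>) (\<xi> 0)) \<in> borel_measurable ?P" for g :: "(nat \<Rightarrow> nat) \<Rightarrow> 'b \<Rightarrow> ennreal"
    using stationary_processD(2)[OF X g, of "n + 1"] trace_Y[of "-1"] trace_Y[of n] by simp

  let ?F = "vimage_algebra (space M) (past X (-1)) (past_space \<pi>)"
  have sub: "subalgebra M ?F"
    unfolding subalgebra_def using sets_image_in_sets[OF refl pastX] by simp
  interpret finite_measure_subalgebra M ?F by unfold_locales (rule sub)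
  let ?C = "past ?Y (-1) -` B \<inter> space M"
  \<comment> \<open>An event of the coded past belongs to the sigma-field of the true past, hence
    may test the conditional expectation.\<close>
  have C: "?C \<in> sets ?F"
  proof -
    have "past X (-1) -` ((\<lambda>x i. c (x i)) -` B \<inter> space (past_space \<pi>)) \<inter> space M \<in> sets ?F"
      by (rule in_vimage_algebra) (rule measurable_sets[OF code B])
    also have "past X (-1) -` ((\<lambda>x i. c (x i)) -` B \<inter> space (past_space \<pi>)) \<inter> space M = ?C"
      using measurable_space[OF pastX[of "-1"]] by (auto simp: pastY)
    finally show ?thesis .
  qed
  have C': "?C \<in> sets M" by measurable
  have int: "integrable M (\<lambda>\<omega>. indicator ?A (X 0 \<omega>) :: real)"
    by (rule integrable_const_bound[of _ 1]) auto
  have qm: "(\<lambda>\<omega>. measure (\<kappa> (past X (-1) \<omega>)) ?A) \<in> borel_measurable M"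
    using measurable_compose[OF pastX measurable_compose[OF kappa measurable_measure_prob_algebra[OF A]]] .
  have kp: "prob_space (\<kappa> x)" if "x \<in> space (past_space \<pi>)" for x
    using measurable_space[OF kappa that] by (simp add: space_prob_algebra)
  have k1: "measure (\<kappa> (past X (-1) \<omega>)) ?A \<le> 1" if "\<omega> \<in> space M" for \<omega>
    using prob_space.prob_le_1[OF kp[OF measurable_space[OF pastX that]]] .
  have "measure M {\<omega>\<in>space M. past ?Y (-1) \<omega> \<in> B \<and> ?Y 0 \<omega> = a} = (\<integral>\<omega>. indicator ?C \<omega> * indicator ?A (X 0 \<omega>) \<partial>M)"
  proof -
    have D: "{\<omega>\<in>space M. past ?Y (-1) \<omega> \<in> B \<and> ?Y 0 \<omega> = a} \<in> sets M" by measurable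
    have "(\<integral>\<omega>. indicator ?C \<omega> * indicator ?A (X 0 \<omega>) \<partial>M) = (\<integral>\<omega>. indicator {\<omega>\<in>space M. past ?Y (-1) \<omega> \<in> B \<and> ?Y 0 \<omega> = a} \<omega> \<partial>M :: real)"
      using measurable_space[OF Xm] by (intro Bochner_Integration.integral_cong) (auto simp: indicator_def)
    then show ?thesis using D by simp
  qed
  also have "\<dots> = (\<integral>\<omega>. indicator ?C \<omega> * real_cond_exp M ?F (\<lambda>\<omega>. indicator ?A (X 0 \<omega>)) \<omega> \<partial>M)"
    using real_cond_exp_intA[OF int C] by (simp add: set_lebesgue_integral_def)
  also have "\<dots> = (\<integral>\<omega>. indicator ?C \<omega> * measure (\<kappa> (past X (-1) \<omega>)) ?A \<partial>M)"
  proof (rule integral_cong_AE)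
    show "(\<lambda>\<omega>. indicator ?C \<omega> * real_cond_exp M ?F (\<lambda>\<omega>. indicator ?A (X 0 \<omega>)) \<omega>) \<in> borel_measurable M"
      using C' by (intro borel_measurable_times borel_measurable_indicator borel_measurable_cond_exp2)
    show "(\<lambda>\<omega>. indicator ?C \<omega> * measure (\<kappa> (past X (-1) \<omega>)) ?A) \<in> borel_measurable M"
      using C' qm by (intro borel_measurable_times borel_measurable_indicator)
    show "AE \<omega> in M. indicator ?C \<omega> * real_cond_exp M ?F (\<lambda>\<omega>. indicator ?A (X 0 \<omega>)) \<omega>
        = indicator ?C \<omega> * measure (\<kappa> (past X (-1) \<omega>)) ?A"
      using cond by eventually_elim simp
  qed
  finally have "emeasure M {\<omega>\<in>space M. past ?Y (-1) \<omega> \<in> B \<and> ?Y 0 \<omega> = a}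
      = ennreal (\<integral>\<omega>. indicator ?C \<omega> * measure (\<kappa> (past X (-1) \<omega>)) ?A \<partial>M)"
    by (simp only: emeasure_eq_measure)
  also have "\<dots> = (\<integral>\<^sup>+\<omega>. ennreal (indicator ?C \<omega> * measure (\<kappa> (past X (-1) \<omega>)) ?A) \<partial>M)"
  proof (rule nn_integral_eq_integral[symmetric])
    show "integrable M (\<lambda>\<omega>. indicator ?C \<omega> * measure (\<kappa> (past X (-1) \<omega>)) ?A)"
    proof (rule integrable_const_bound[of _ 1])
      show "AE \<omega> in M. norm (indicator ?C \<omega> * measure (\<kappa> (past X (-1) \<omega>)) ?A) \<le> 1"
        using k1 by (auto simp: indicator_def)
      show "(\<lambda>\<omega>. indicator ?C \<omega> * measure (\<kappa> (past X (-1) \<omega>)) ?A) \<in> borel_measurable M"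
        using C' qm by (intro borel_measurable_times borel_measurable_indicator)
    qed
  qed simp
  also have "\<dots> = (\<integral>\<^sup>+\<omega>. indicator B (past ?Y (-1) \<omega>) * ?q (past ?Y (-1) \<omega>) \<partial>M)"
    using kappa_code[OF measurable_space[OF pastX]]
    by (intro nn_integral_cong) (auto simp: indicator_def pastY)
  finally have base: "emeasure M {\<omega>\<in>space M. past ?Y (-1) \<omega> \<in> B \<and> ?Y 0 \<omega> = a}
      = (\<integral>\<^sup>+\<omega>. indicator B (past ?Y (-1) \<omega>) * ?q (past ?Y (-1) \<omega>) \<partial>M)" .

  have ind: "emeasure M {\<omega>\<in>space M. past ?Y n \<omega> \<in> B \<and> ?Y k \<omega> = a}
      = (\<integral>\<^sup>+\<omega>. indicator B (past ?Y n \<omega>) * indicator ?A (X k \<omega>) \<partial>M)" for n k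
  proof -
    have D: "{\<omega>\<in>space M. past ?Y n \<omega> \<in> B \<and> ?Y k \<omega> = a} \<in> sets M" by measurable
    show ?thesis
      unfolding nn_integral_indicator[OF D, symmetric] using measurable_space[OF Xm]
      by (intro nn_integral_cong) (auto simp: indicator_def)
  qed
  have "emeasure M {\<omega>\<in>space M. past ?Y n \<omega> \<in> B \<and> ?Y (n + 1) \<omega> = a}
      = (\<integral>\<^sup>+\<omega>. indicator B (past ?Y (-1) \<omega>) * indicator ?A (X 0 \<omega>) \<partial>M)"
    unfolding ind by (rule shift[of "\<lambda>s e. indicator B s * indicator ?A e"]) measurable
  also have "\<dots> = (\<integral>\<^sup>+\<omega>. indicator B (past ?Y (-1) \<omega>) * ?q (past ?Y (-1) \<omega>) \<partial>M)"
    using base ind[of "-1" 0] by simp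
  also have "\<dots> = (\<integral>\<^sup>+\<omega>. indicator B (past ?Y n \<omega>) * ?q (past ?Y n \<omega>) \<partial>M)"
    by (rule shift[of "\<lambda>s e. indicator B s * ?q s", symmetric]) measurable
  finally show ?thesis .
qed

lemma admits_generating_parametrization_if_coupling:
  fixes M :: "'a measure" and \<nu> :: "(nat \<Rightarrow> real) measure" and \<alpha> :: "nat \<Rightarrow> real"
  assumes M: "prob_space M" and X: "stationary_process M \<pi> X"
    and \<kappa>: "regular_conditional_law M \<pi> (X 0) (past_space \<pi>) (past X (-1)) \<kappa>"
    and c: "c \<in> \<pi> \<rightarrow>\<^sub>M count_space (UNIV :: nat set)"
    and rep: "\<And>a. rep a \<in> space \<pi>" "\<And>A e. A \<in> sets \<pi> \<Longrightarrow> e \<in> space \<pi> \<Longrightarrow> rep (c e) \<in> A \<longleftrightarrow> e \<in> A"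
    and \<nu>: "prob_space \<nu>"
    and \<phi>: "case_prod \<phi> \<in> past_space (count_space UNIV) \<Otimes>\<^sub>M \<nu> \<rightarrow>\<^sub>M count_space UNIV"
    and law: "\<And>s a. measure \<nu> {u\<in>space \<nu>. \<phi> s u = a} = measure (\<kappa> (\<lambda>i. rep (s i))) {e\<in>space \<pi>. c e = a}"
    and alpha: "\<And>n. 0 \<le> \<alpha> n" "\<And>n. \<alpha> n \<le> 1" "decseq \<alpha>"
    and diverges: "(\<Sum>k. ennreal (\<Prod>n=0..k. 1 - \<alpha> n)) = \<infinity>"
    and coupling: "\<And>s t l. (\<And>i. i < l \<Longrightarrow> s i = t i) \<Longrightarrow> measure \<nu> {u\<in>space \<nu>. \<phi> s u \<noteq> \<phi> t u} \<le> \<alpha> l"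
  shows "admits_generating_parametrization M \<pi> X"
proof -
  interpret M: prob_space M by (rule M)
  interpret \<nu>: prob_space \<nu> by (rule \<nu>)
  note Xm = stationary_processD(1)[OF X]
  interpret driven_process M \<nu> "\<lambda>n. c \<circ> X n" \<phi>
  proof unfold_locales
    show "c \<circ> X n \<in> M \<rightarrow>\<^sub>M count_space UNIV" for n by (rule measurable_comp[OF Xm c])
    show "case_prod \<phi> \<in> past_space (count_space UNIV) \<Otimes>\<^sub>M \<nu> \<rightarrow>\<^sub>M count_space UNIV" by (rule \<phi>)
  next
    fix n a and B :: "(nat \<Rightarrow> nat) set" assume "B \<in> sets (past_space (count_space UNIV))"
    from coded_cond_law[OF M X \<kappa> c rep this, of n a]
    show "emeasure M {\<omega>\<in>space M. past (\<lambda>n. c \<circ> X n) n \<omega> \<in> B \<and> (c \<circ> X (n + 1)) \<omega> = a} =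
      (\<integral>\<^sup>+\<omega>. indicator B (past (\<lambda>n. c \<circ> X n) n \<omega>) *
        emeasure \<nu> {u\<in>space \<nu>. \<phi> (past (\<lambda>n. c \<circ> X n) n \<omega>) u = a} \<partial>M)"
      by (simp only: \<nu>.emeasure_eq_measure law)
  qed
  have "generating_parametrization enlarged (count_space UNIV) (\<lambda>n. c \<circ> X n \<circ> fst) \<nu> (\<lambda>n x. snd x n)"
    by (rule generating_parametrization_enlarged[OF alpha diverges coupling])
  then have "generating_parametrization enlarged (count_space UNIV) (\<lambda>n. c \<circ> (X n \<circ> fst)) \<nu> (\<lambda>n x. snd x n)"
    by (simp only: comp_assoc)
  then have "generating_parametrization enlarged \<pi> (\<lambda>n. X n \<circ> fst) \<nu> (\<lambda>n x. snd x n)"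
    using measurable_comp[OF measurable_fst_enlarged Xm]
    by (intro generating_parametrization_coding[OF _ prob_space_enlarged _ c rep(2)])
  with enlargement_enlarged show ?thesis
    unfolding admits_generating_parametrization_def by blast
qed

text \<open>Two thresholds read against the same uniform variable give different answers exactly
  when the variable falls between them.\<close>

lemma measure_threshold:
  assumes "0 \<le> q" "q \<le> 1"
  shows "measure (uniform_seq 1) {u. u 0 < q} = q" "measure (uniform_seq 1) {u. \<not> u 0 < q} = 1 - q"
    "0 \<le> r \<Longrightarrow> r \<le> 1 \<Longrightarrow> measure (uniform_seq 1) {u. (u 0 < q) \<noteq> (u 0 < r)} = \<bar>q - r\<bar>"
proof -
  have m: "measure (uniform_seq 1) {u. u 0 \<in> A} = measure lborel ({0..<1} \<inter> A)" if A: "A \<in> sets borel" for A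
    using measure_uniform_seq_0[OF zero_less_one A] A by (simp add: measure_uniform_measure)
  have "{0..<1} \<inter> {t. t < q} = {0..<q}" using assms by auto
  then show "measure (uniform_seq 1) {u. u 0 < q} = q" using m[of "{t. t < q}"] assms by simp
  have "{0..<1} \<inter> {t. \<not> t < q} = {q..<1}" using assms by auto
  then show "measure (uniform_seq 1) {u. \<not> u 0 < q} = 1 - q" using m[of "{t. \<not> t < q}"] assms by simp
  assume "0 \<le> r" "r \<le> 1"
  then have "{0..<1} \<inter> {t. (t < q) \<noteq> (t < r)} = {min q r..<max q r}"
    using assms by (auto simp: min_def max_def)
  then show "measure (uniform_seq 1) {u. (u 0 < q) \<noteq> (u 0 < r)} = \<bar>q - r\<bar>"
    using m[of "{t. (t < q) \<noteq> (t < r)}"] by (simp add: min_def max_def abs_if)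
qed

theorem theorem1:
  fixes M :: "'a measure" and \<pi> :: "'e measure"
    and X :: "int \<Rightarrow> 'a \<Rightarrow> 'e"
    and \<kappa> :: "(nat \<Rightarrow> 'e) \<Rightarrow> 'e measure"
    and f :: "(nat \<Rightarrow> 'e) \<Rightarrow> 'e \<Rightarrow> real"
    and \<delta> :: "nat \<Rightarrow> real"
  assumes "prob_space M"
    and "sigma_finite_measure \<pi>"
    and "stationary_process M \<pi> X"
    and "regular_conditional_law M \<pi> (X 0) (past_space \<pi>) (past X (-1)) \<kappa>"
    and "\<And>x. x \<in> space (past_space \<pi>) \<Longrightarrow> f x \<in> borel_measurable \<pi>"
    and "\<And>x e. x \<in> space (past_space \<pi>) \<Longrightarrow> e \<in> space \<pi> \<Longrightarrow> 0 \<le> f x e"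
    and "\<And>x. x \<in> space (past_space \<pi>) \<Longrightarrow> \<kappa> x = density \<pi> (\<lambda>e. ennreal (f x e))"
    and "\<And>n. \<delta> n = influence \<pi> f n"
  shows "(finite (space \<pi>) \<and>
          (\<Sum>k. ennreal (\<Prod>n=0..k. (1 - \<delta> n) / (1 + \<delta> n))) = \<infinity>
            \<longrightarrow> admits_generating_parametrization M \<pi> X) \<and>
         (card (space \<pi>) = 2 \<and>
          (\<Sum>k. ennreal (\<Prod>n=0..k. 1 - \<delta> n)) = \<infinity>
            \<longrightarrow> admits_generating_parametrization M \<pi> X)"
proof -
  note M = assms(1) and X = assms(3) and \<kappa> = assms(4)
  interpret prob_space M by (rule M)
  note Xm = stationary_processD(1)[OF X]
  have kappa: "\<kappa> \<in> past_space \<pi> \<rightarrow>\<^sub>M prob_algebra \<pi>"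
    using \<kappa> unfolding regular_conditional_law_def by blast
  have kappa_prob: "prob_space (\<kappa> x)" and kappa_sets: "sets (\<kappa> x) = sets \<pi>" if "x \<in> space (past_space \<pi>)" for x
    using measurable_space[OF kappa that] by (simp_all add: space_prob_algebra)
  have ne: "space \<pi> \<noteq> {}" using not_empty measurable_space[OF Xm[of 0]] by blast
  note densities = kappa_prob assms(5-7) ne
  have delta: "0 \<le> \<delta> n" "\<delta> n \<le> 1" "decseq \<delta>" for n
    using influence_bounds[OF densities] influence_decseq[OF densities] assms(8) by (simp_all add: decseq_def)

  have main: "admits_generating_parametrization M \<pi> X"
    if fin: "finite (space \<pi>)" and hyp:
      "(\<Sum>k. ennreal (\<Prod>n=0..k. (1 - \<delta> n) / (1 + \<delta> n))) = \<infinity> \<or>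
       card (space \<pi>) = 2 \<and> (\<Sum>k. ennreal (\<Prod>n=0..k. 1 - \<delta> n)) = \<infinity>"
  proof -
    obtain c :: "'e \<Rightarrow> nat" and rep where c: "c \<in> \<pi> \<rightarrow>\<^sub>M count_space UNIV"
      and c_less: "\<And>e. e \<in> space \<pi> \<Longrightarrow> c e < card (space \<pi>)" and rep_space: "\<And>a. rep a \<in> space \<pi>"
      and rep: "\<And>A e. A \<in> sets \<pi> \<Longrightarrow> e \<in> space \<pi> \<Longrightarrow> rep (c e) \<in> A \<longleftrightarrow> e \<in> A"
      using finite_space_coding[OF fin ne] by metis
    define m where "m = card (space \<pi>)"
    have m: "0 < m" unfolding m_def using fin ne by (simp add: card_gt_0_iff)
    define lift where "lift s i = rep (s i)" for s :: "nat \<Rightarrow> nat" and i :: nat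
    have lift_space: "lift s \<in> space (past_space \<pi>)" for s
      by (simp add: lift_def past_space_def space_PiM PiE_iff rep_space)
    have lift: "lift \<in> past_space (count_space UNIV) \<rightarrow>\<^sub>M past_space \<pi>"
      unfolding past_space_def lift_def using rep_space
      by (intro measurable_PiM_single') (auto simp: space_PiM)
    have fiber: "{e\<in>space \<pi>. c e = a} \<in> sets \<pi>" for a using c by measurable
    define p where "p s a = measure (\<kappa> (lift s)) {e\<in>space \<pi>. c e = a}" for s a
    have p_eq: "p s a = measure (\<kappa> (\<lambda>i. rep (s i))) {e\<in>space \<pi>. c e = a}" for s a
      by (simp add: p_def lift_def[abs_def])
    have p_meas: "(\<lambda>s. p s a) \<in> borel_measurable (past_space (count_space UNIV))" for a
      unfolding p_def
      by (rule measurable_compose[OF lift measurable_compose[OF kappa measurable_measure_prob_algebra[OF fiber]]])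
    have p_nonneg: "0 \<le> p s a" for s a by (simp add: p_def)
    have p_ge: "p s a = 0" if "m \<le> a" for s a
    proof -
      have "{e\<in>space \<pi>. c e = a} = {}" using c_less that by (force simp: m_def)
      then show ?thesis by (simp only: p_def measure_empty)
    qed
    have p_sum: "(\<Sum>a<m. p s a) = 1" for s
    proof -
      interpret k: prob_space "\<kappa> (lift s)" by (rule kappa_prob[OF lift_space])
      have "(\<Sum>a<m. p s a) = measure (\<kappa> (lift s)) (\<Union>a\<in>{..<m}. {e\<in>space \<pi>. c e = a})"
        unfolding p_def using fiber
        by (intro k.finite_measure_finite_Union[symmetric]) (auto simp: kappa_sets[OF lift_space] disjoint_family_on_def)
      also have "(\<Union>a\<in>{..<m}. {e\<in>space \<pi>. c e = a}) = space (\<kappa> (lift s))"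
        using c_less sets_eq_imp_space_eq[OF kappa_sets[OF lift_space]] by (auto simp: m_def)
      finally show ?thesis by (simp add: k.prob_space)
    qed
    define tv where "tv s t = (\<Sum>a<m. \<bar>p s a - p t a\<bar>) / 2" for s t
    have tv_le: "tv s t \<le> \<delta> l" if eq: "\<And>i. i < l \<Longrightarrow> s i = t i" for s t l
    proof -
      have "tv s t \<le> density_dist \<pi> (f (lift s)) (f (lift t))"
        unfolding tv_def p_def
        by (rule total_variation_le_density_dist[OF densities lift_space lift_space c])
      also have "\<dots> \<le> \<delta> l"
      proof -
        have "lift s i = lift t i" if "i < l" for i using eq[OF that] unfolding lift_def by (rule arg_cong)
        then show ?thesis
          unfolding assms(8) by - (rule density_dist_le_influence[OF densities lift_space lift_space], assumption+)
      qed
      finally show ?thesis .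
    qed
    have tv_nonneg: "0 \<le> tv s t" for s t unfolding tv_def by (simp add: sum_nonneg)
    note criterion = admits_generating_parametrization_if_coupling[OF M X \<kappa> c rep_space rep]

    show ?thesis using hyp
    proof
      assume div: "(\<Sum>k. ennreal (\<Prod>n=0..k. (1 - \<delta> n) / (1 + \<delta> n))) = \<infinity>"
      define \<alpha> where "\<alpha> n = 2 * \<delta> n / (1 + \<delta> n)" for n
      \<comment> \<open>Monotonicity of the rejection error in the distance serves twice: it makes
        \<alpha> decreasing and turns the bound on \<open>tv\<close> into one on the coupling
        error.\<close>
      have mono: "2 * d / (1 + d) \<le> 2 * d' / (1 + d')" if "0 \<le> d" "d \<le> d'" for d d' :: real
        using that by (simp add: field_simps)
      have compl: "1 - \<alpha> n = (1 - \<delta> n) / (1 + \<delta> n)" for n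
        using delta(1)[of n] by (simp add: \<alpha>_def field_simps)
      show ?thesis
      proof (rule criterion)
        show "prob_space (uniform_seq m)" by (rule prob_space_uniform_seq[OF m])
        show "(\<lambda>(s, u). first_accepted (p s) u) \<in> past_space (count_space UNIV) \<Otimes>\<^sub>M uniform_seq m \<rightarrow>\<^sub>M count_space UNIV"
          by (rule measurable_first_accepted[OF p_meas])
        show "measure (uniform_seq m) {u\<in>space (uniform_seq m). first_accepted (p s) u = a}
            = measure (\<kappa> (\<lambda>i. rep (s i))) {e\<in>space \<pi>. c e = a}" for s a
          using measure_first_accepted[OF m p_nonneg p_sum p_ge, of s a] by (simp add: p_eq[symmetric])
        show "0 \<le> \<alpha> n" "\<alpha> n \<le> 1" for n
          using delta(1,2)[of n] by (auto simp: \<alpha>_def field_simps)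
        show "decseq \<alpha>" using delta(1,3) mono by (simp add: decseq_def \<alpha>_def)
        show "(\<Sum>k. ennreal (\<Prod>n=0..k. 1 - \<alpha> n)) = \<infinity>" unfolding compl by (rule div)
        show "measure (uniform_seq m) {u\<in>space (uniform_seq m). first_accepted (p s) u \<noteq> first_accepted (p t) u} \<le> \<alpha> l"
          if "\<And>i. i < l \<Longrightarrow> s i = t i" for s t l
        proof -
          have "tv s t \<le> \<delta> l" by (rule tv_le) (rule that)
          from mono[OF tv_nonneg this] show ?thesis
            using measure_first_accepted_neq[OF m p_nonneg p_sum p_nonneg p_sum tv_def, of s t]
            by (simp add: \<alpha>_def)
        qed
      qed
    next
      assume div: "card (space \<pi>) = 2 \<and> (\<Sum>k. ennreal (\<Prod>n=0..k. 1 - \<delta> n)) = \<infinity>"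
      then have m2: "m = 2" by (simp add: m_def)
      have p1: "p s 1 = 1 - p s 0" for s using p_sum[of s] by (simp add: m2 numeral_2_eq_2)
      have p0: "p s 0 \<le> 1" for s using p1[of s] p_nonneg[of s 1] by simp
      \<comment> \<open>With two codes the two absolute differences coincide, so the distance is
        that of the thresholds, and the quantile coupling attains it.\<close>
      have tv2: "tv s t = \<bar>p s 0 - p t 0\<bar>" for s t
        using p1[of s] p1[of t] by (simp add: tv_def m2 numeral_2_eq_2)
      let ?\<phi> = "\<lambda>s u. if u 0 < p s 0 then 0 else 1 :: nat"
      show ?thesis
      proof (rule criterion)
        show "prob_space (uniform_seq 1)" by (rule prob_space_uniform_seq) simp
        have [measurable]: "(\<lambda>q. p (fst q) 0) \<in> borel_measurable (past_space (count_space UNIV) \<Otimes>\<^sub>M uniform_seq 1)"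
          "(\<lambda>q. snd q 0) \<in> borel_measurable (past_space (count_space (UNIV :: nat set)) \<Otimes>\<^sub>M uniform_seq 1)"
          using measurable_compose[OF measurable_fst p_meas] by measurable
        show "(\<lambda>(s, u). ?\<phi> s u) \<in> past_space (count_space UNIV) \<Otimes>\<^sub>M uniform_seq 1 \<rightarrow>\<^sub>M count_space UNIV"
          unfolding split_beta by measurable
        show "measure (uniform_seq 1) {u\<in>space (uniform_seq 1). ?\<phi> s u = a}
            = measure (\<kappa> (\<lambda>i. rep (s i))) {e\<in>space \<pi>. c e = a}" for s a
        proof -
          have "measure (uniform_seq 1) {u\<in>space (uniform_seq 1). ?\<phi> s u = a} = p s a"
          proof -
            consider "a = 0" | "a = 1" | "m \<le> a" using m2 by linarith
            then show ?thesis
            proof cases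
              case 1
              then have "{u\<in>space (uniform_seq 1). ?\<phi> s u = a} = {u. u 0 < p s 0}" by auto
              then show ?thesis using 1 measure_threshold(1)[OF p_nonneg p0] by simp
            next
              case 2
              then have "{u\<in>space (uniform_seq 1). ?\<phi> s u = a} = {u. \<not> u 0 < p s 0}" by auto
              then show ?thesis using 2 measure_threshold(2)[OF p_nonneg p0] p1 by simp
            next
              case 3
              then have "{u\<in>space (uniform_seq 1). ?\<phi> s u = a} = {}" using m2 by auto
              then show ?thesis using p_ge[OF 3] by simp
            qed
          qed
          then show ?thesis by (simp only: p_eq)
        qed
        show "0 \<le> \<delta> n" "\<delta> n \<le> 1" "decseq \<delta>" for n by (rule delta)+
        show "(\<Sum>k. ennreal (\<Prod>n=0..k. 1 - \<delta> n)) = \<infinity>" using div by simp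
        show "measure (uniform_seq 1) {u\<in>space (uniform_seq 1). ?\<phi> s u \<noteq> ?\<phi> t u} \<le> \<delta> l"
          if "\<And>i. i < l \<Longrightarrow> s i = t i" for s t l
        proof -
          have "{u\<in>space (uniform_seq 1). ?\<phi> s u \<noteq> ?\<phi> t u} = {u. (u 0 < p s 0) \<noteq> (u 0 < p t 0)}" by auto
          moreover have "tv s t \<le> \<delta> l" by (rule tv_le) (rule that)
          ultimately show ?thesis
            using measure_threshold(3)[OF p_nonneg p0 p_nonneg p0, of s t] by (simp add: tv2)
        qed
      qed
    qed
  qed
  have "finite (space \<pi>)" if "card (space \<pi>) = 2" using that card.infinite by fastforce
  with main show ?thesis by blast
qed

end
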